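(* Let $G$ be a group with a representation of locally bounded type on a weakly locally compact convex proper cone $C$ in a Hausdorff locally convex space $E$. If the action is distal on $C$, then $G$ fixes a non-zero point in $C$.
   Context: Vector spaces are real. A convex cone $C\subseteq E$ is a subset with $C+C\subseteq C$ and $\mathbf{R}_+C\subseteq C$; it is proper if $C\cap(-C)=\{0\}$. It is weakly locally compact if it is locally compact in the topology induced by the weak topology $\sigma(E,E')$. A $G$-representation on a cone $C\subseteq E$ is an action of the (abstract) group $G$ on $E$ by continuous linear maps preserving $C$. The representation is of locally bounded type if there is $x\neq 0$ in $C$ whose orbit $Gx$ is bounded in the sense of topological vector spaces (absorbed by every neighbourhood of zero). The action is distal on $C$ if for all $x\neq y$ in $C$, the origin is not in the closure (in the given topology of $E$) of $\{gx-gy : g\in G\}$. *)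

theory Defs
  imports "HOL-Analysis.Analysis" "HOL-Algebra.Group_Action"
begin

class topological_vector_space = real_vector + topological_group_add +
  assumes tendsto_scaleR_Pair:
    "LIM p (nhds (c::real) \<times>\<^sub>F nhds x). fst p *\<^sub>R snd p :> nhds (c *\<^sub>R x)"

text \<open>The constant \<^const>\<open>convex\<close>, with its sort constraint \<^class>\<open>real_vector\<close>, cannot occur in a class specification,
  so its definition is written out here.\<close>

class locally_convex_space = topological_vector_space +
  assumes convex_nhds_zero_base':
    "open U \<Longrightarrow> 0 \<in> U \<Longrightarrow>
       \<exists>V. (\<forall>x\<in>V. \<forall>y\<in>V. \<forall>u\<ge>0. \<forall>v\<ge>0. u + v = 1 \<longrightarrow> u *\<^sub>R x + v *\<^sub>R y \<in> V) \<and>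
         (\<exists>W. open W \<and> 0 \<in> W \<and> W \<subseteq> V) \<and> V \<subseteq> U"

lemma convex_nhds_zero_base:
  fixes U :: "'a::locally_convex_space set"
  assumes "open U" "0 \<in> U"
  shows "\<exists>V. convex V \<and> 0 \<in> interior V \<and> V \<subseteq> U"
  using convex_nhds_zero_base'[OF assms] unfolding convex_def interior_def by blast

definition topological_dual :: "('a::topological_vector_space \<Rightarrow> real) set" where
  "topological_dual = {f. linear f \<and> continuous_on UNIV f}"

text \<open>The topology \<open>\<sigma>(E, E')\<close>, where \<open>E\<close> is the whole type.\<close>

definition weak_topology :: "'a::topological_vector_space topology" where
  "weak_topology =
     topology_generated_by {f -` U |f U. f \<in> topological_dual \<and> open U}"

definition proper_cone :: "'a::real_vector set \<Rightarrow> bool" where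
  "proper_cone C \<longleftrightarrow> C \<inter> uminus ` C = {0}"

definition weakly_locally_compact :: "'a::topological_vector_space set \<Rightarrow> bool" where
  "weakly_locally_compact C \<longleftrightarrow> locally_compact_space (subtopology weak_topology C)"

text \<open>Boundedness in the sense of topological vector spaces; \<^const>\<open>bounded\<close> is the metric notion.
  Absorption by every open neighbourhood of zero implies absorption by every neighbourhood.\<close>

definition tvs_bounded :: "'a::topological_vector_space set \<Rightarrow> bool" where
  "tvs_bounded B \<longleftrightarrow>
     (\<forall>U. open U \<and> 0 \<in> U \<longrightarrow> (\<exists>r>0. \<forall>t. r \<le> \<bar>t\<bar> \<longrightarrow> B \<subseteq> (\<lambda>x. t *\<^sub>R x) ` U))"

text \<open>\<^locale>\<open>group_action\<close> includes that \<open>G\<close> is a group. The action is on the whole space, and \<open>G\<close>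
  carries no topology.\<close>

definition cone_representation ::
  "('g, 'm) monoid_scheme \<Rightarrow> ('g \<Rightarrow> 'a \<Rightarrow> 'a) \<Rightarrow> 'a::topological_vector_space set \<Rightarrow> bool" where
  "cone_representation G \<pi> C \<longleftrightarrow>
     group_action G UNIV \<pi> \<and>
     (\<forall>g\<in>carrier G. linear (\<pi> g) \<and> continuous_on UNIV (\<pi> g) \<and> \<pi> g ` C \<subseteq> C)"

definition locally_bounded_type ::
  "('g, 'm) monoid_scheme \<Rightarrow> ('g \<Rightarrow> 'a \<Rightarrow> 'a) \<Rightarrow> 'a::topological_vector_space set \<Rightarrow> bool" where
  "locally_bounded_type G \<pi> C \<longleftrightarrow> (\<exists>x\<in>C. x \<noteq> 0 \<and> tvs_bounded (orbit G \<pi> x))"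

definition distal_on ::
  "('g, 'm) monoid_scheme \<Rightarrow> ('g \<Rightarrow> 'a \<Rightarrow> 'a) \<Rightarrow> 'a::topological_vector_space set \<Rightarrow> bool" where
  "distal_on G \<pi> C \<longleftrightarrow>
     (\<forall>x\<in>C. \<forall>y\<in>C. x \<noteq> y \<longrightarrow> 0 \<notin> closure {\<pi> g x - \<pi> g y |g. g \<in> carrier G})"

end

theory Submission
  imports Defs
begin

text \<open>
  Local compactness and properness give \<open>C\<close> a weakly compact base: there is a continuous linear
  functional \<open>\<phi>\<close>, positive on \<open>C - {0}\<close>, all of whose sections \<open>{c \<in> C. \<phi> c \<le> r}\<close> are weakly
  compact (\<open>weakly_locally_compact_cone_compact_base\<close>). Along a bounded orbit \<open>G x\<close> the functional \<open>\<phi>\<close>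
  is bounded above. It is also bounded away from zero: every continuous seminorm is bounded on the
  section \<open>{c \<in> C. \<phi> c \<le> 1}\<close>, so \<open>\<phi> (g x) \<rightarrow> 0\<close> would force \<open>g x \<rightarrow> 0\<close> in the given topology, which
  distality excludes for the pair \<open>x\<close>, \<open>0\<close>. Hence the set of all \<open>y \<in> C\<close> whose orbit satisfies the same
  two bounds is nonempty, convex, weakly compact, invariant, and does not contain zero. It remains to find
  a fixed point in it.

  That is the fixed point theorem of Ryll-Nardzewski (\<open>distal_common_fixed_point\<close>). By weak
  compactness it is enough to treat finitely many maps \<open>T\<^sub>1, \<dots>, T\<^sub>n\<close>. Their average has a fixed point
  \<open>y\<close> by the Markov--Kakutani argument. If some \<open>T\<^sub>i\<close> moved \<open>y\<close>, distality would give a continuous seminorm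
  \<open>p\<close> with \<open>p (S T\<^sub>i y - S y) \<ge> 1\<close> for every \<open>S\<close> in the semigroup and every \<open>T\<^sub>i\<close> that moves \<open>y\<close>. On the other hand
  the countable set of points \<open>S y\<close>, with \<open>S\<close> a word in the \<open>T\<^sub>i\<close>, has a slice
  \<open>{f > \<alpha>}\<close> that is nonempty and of small \<open>p\<close>-diameter
  (\<open>weakly_compact_countable_small_slice\<close>). Since \<open>S y\<close> is the mean of the \<open>S T\<^sub>i y\<close>, a point \<open>S y\<close> of the slice is
  accompanied by some \<open>S T\<^sub>i y\<close> in the slice with \<open>T\<^sub>i y \<noteq> y\<close>, which is a contradiction.

  The slice lemma is a form of dentability due to Namioka and Asplund. Instead of the extreme points
  of the closed convex hull of the given countable set \<open>Y\<close>, the proof uses a minimal weakly closed subset \<open>L\<close> of that hull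
  on which every functional reaches its supremum over \<open>Y\<close>. Countably many small \<open>p\<close>-balls cover \<open>L\<close> and are weakly
  closed, so by the Baire category theorem one of them contains a relatively open piece of \<open>L\<close>. Minimality says directly
  that removing this piece lowers the maximum of some functional, which then defines the slice; the theorems of
  Krein--Milman and Milman are thus avoided.
\<close>

section \<open>Sublinear functionals and the Hahn-Banach theorem\<close>

definition sublinear :: "('a::real_vector \<Rightarrow> real) \<Rightarrow> bool" where
  "sublinear q \<longleftrightarrow> (\<forall>x y. q (x + y) \<le> q x + q y) \<and> (\<forall>t x. 0 \<le> t \<longrightarrow> q (t *\<^sub>R x) = t * q x)"

lemma sublinear_add: "sublinear q \<Longrightarrow> q (x + y) \<le> q x + q y"
  by (simp add: sublinear_def)

lemma sublinear_scale: "sublinear q \<Longrightarrow> 0 \<le> t \<Longrightarrow> q (t *\<^sub>R x) = t * q x"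
  by (simp add: sublinear_def)

lemma sublinear_0: "sublinear q \<Longrightarrow> q 0 = 0"
  using sublinear_scale[of q 0 0] by simp

lemma sublinear_minus: "sublinear q \<Longrightarrow> - q (- x) \<le> q x"
  using sublinear_add[of q x "- x"] sublinear_0[of q] by simp

lemma linear_sublinear: "linear f \<Longrightarrow> sublinear f"
  by (simp add: sublinear_def linear_add linear_scale)

text \<open>The functional \<open>q\<close> lowered as far as additivity along the ray through \<open>x\<close> demands: the result lies below
  \<open>q\<close> and is at most \<open>- q x\<close> at \<open>- x\<close>. A sublinear \<open>q\<close> is additive in the direction \<open>x\<close> precisely when lowering it
  in this way changes nothing.\<close>

definition lower_along :: "('a::real_vector \<Rightarrow> real) \<Rightarrow> 'a \<Rightarrow> 'a \<Rightarrow> real" where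
  "lower_along q x y = (INF t\<in>{0..}. q (y + t *\<^sub>R x) - t * q x)"

lemma lower_along:
  assumes q: "sublinear q"
  shows sublinear_lower_along: "sublinear (lower_along q x)"
    and lower_along_le: "lower_along q x y \<le> q y"
    and lower_along_le_diff: "lower_along q x y \<le> q (y + x) - q x"
proof -
  define r where "r = lower_along q x"
  have lower: "- q (- y) \<le> q (y + t *\<^sub>R x) - t * q x" if "0 \<le> t" for t y
    using sublinear_add[OF q, of "y + t *\<^sub>R x" "- y"] sublinear_scale[OF q that, of x] by simp
  have bdd: "bdd_below ((\<lambda>t. q (y + t *\<^sub>R x) - t * q x) ` {0..})" for y
    using lower by (intro bdd_belowI[where m = "- q (- y)"]) auto
  have upper: "r y \<le> q (y + t *\<^sub>R x) - t * q x" if "0 \<le> t" for t y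
    unfolding r_def lower_along_def using bdd that by (intro cINF_lower) auto
  have great: "z \<le> r y" if "\<And>t. 0 \<le> t \<Longrightarrow> z \<le> q (y + t *\<^sub>R x) - t * q x" for z y
    unfolding r_def lower_along_def using that by (intro cINF_greatest) auto
  show "lower_along q x y \<le> q y" for y
    using upper[of 0 y] by (simp add: r_def)
  show "lower_along q x y \<le> q (y + x) - q x" for y
    using upper[of 1 y] by (simp add: r_def)
  have add: "r (y + z) \<le> r y + r z" for y z
  proof -
    have "r (y + z) - (q (z + t *\<^sub>R x) - t * q x) \<le> q (y + s *\<^sub>R x) - s * q x"
      if "0 \<le> s" "0 \<le> t" for s t
      using upper[of "s + t" "y + z"] that sublinear_add[OF q, of "y + s *\<^sub>R x" "z + t *\<^sub>R x"]
      by (simp add: algebra_simps)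
    then have "r (y + z) - (q (z + t *\<^sub>R x) - t * q x) \<le> r y" if "0 \<le> t" for t
      using that by (intro great)
    then have "r (y + z) - r y \<le> q (z + t *\<^sub>R x) - t * q x" if "0 \<le> t" for t
      using that by (simp add: algebra_simps)
    then have "r (y + z) - r y \<le> r z"
      by (intro great)
    then show ?thesis by simp
  qed
  have r0: "r 0 = 0"
    using upper[of 0 0] great[of 0 0] lower[of _ 0] sublinear_0[OF q] by force
  have le: "r (s *\<^sub>R y) \<le> s * r y" if "0 < s" for s y
  proof -
    have "r (s *\<^sub>R y) / s \<le> q (y + t *\<^sub>R x) - t * q x" if "0 \<le> t" for t
    proof -
      have "r (s *\<^sub>R y) \<le> q (s *\<^sub>R (y + t *\<^sub>R x)) - (s * t) * q x"
        using upper[of "s * t" "s *\<^sub>R y"] that \<open>0 < s\<close> by (simp add: scaleR_add_right)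
      also have "\<dots> = s * (q (y + t *\<^sub>R x) - t * q x)"
        using sublinear_scale[OF q, of s "y + t *\<^sub>R x"] \<open>0 < s\<close> by (simp add: algebra_simps)
      finally show ?thesis using \<open>0 < s\<close> by (simp add: field_simps)
    qed
    then have "r (s *\<^sub>R y) / s \<le> r y" by (rule great)
    then show ?thesis using that by (simp add: field_simps)
  qed
  have "r (s *\<^sub>R y) = s * r y" if "0 \<le> s" for s y
  proof (cases "s = 0")
    case False
    then have "0 < s" using that by simp
    moreover have "s * r y \<le> r (s *\<^sub>R y)"
      using le[of "1 / s" "s *\<^sub>R y"] \<open>0 < s\<close> by (simp add: field_simps)
    ultimately show ?thesis using le[of s y] by simp
  qed (simp add: r0)
  then show "sublinear (lower_along q x)"
    using add by (simp add: sublinear_def r_def)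
qed

text \<open>Zorn's lemma applies because pointwise infima of chains of sublinear functionals below \<open>p\<close> stay finite:
  sublinearity bounds each of them below by \<open>\<lambda>x. - p (- x)\<close>.\<close>

lemma minimal_sublinear_exists:
  fixes p :: "'a::real_vector \<Rightarrow> real"
  assumes p: "sublinear p"
  obtains f where "sublinear f" "\<And>x. f x \<le> p x"
    "\<And>q x. sublinear q \<Longrightarrow> (\<And>x. q x \<le> f x) \<Longrightarrow> q x = f x"
proof -
  define S where "S = {q. sublinear q \<and> (\<forall>x. q x \<le> p x)}"
  define R :: "('a \<Rightarrow> real) \<Rightarrow> ('a \<Rightarrow> real) \<Rightarrow> bool" where "R = (\<lambda>q r. \<forall>x. r x \<le> q x)"
  have bound: "- p (- x) \<le> q x" if "q \<in> S" for q x
  proof -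
    have "- p (- x) \<le> - q (- x)" using that by (simp add: S_def)
    also have "\<dots> \<le> q x" using that by (auto simp: S_def intro: sublinear_minus)
    finally show ?thesis .
  qed
  have "\<exists>m\<in>S. \<forall>a\<in>S. R m a \<longrightarrow> a = m"
  proof (rule predicate_Zorn)
    show "partial_order_on S (relation_of R S)"
      unfolding R_def by (intro partial_order_on_relation_ofI) (auto intro: order_trans antisym simp: fun_eq_iff)
  next
    fix c assume "c \<in> Chains (relation_of R S)"
    then have cS: "c \<subseteq> S" and tot: "\<And>q r. q \<in> c \<Longrightarrow> r \<in> c \<Longrightarrow> R q r \<or> R r q"
      by (auto simp: Chains_def relation_of_def)
    show "\<exists>u\<in>S. \<forall>a\<in>c. R a u"
    proof (cases "c = {}")
      case True
      then show ?thesis using p by (auto simp: S_def)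
    next
      case False
      define u where "u x = (INF q\<in>c. q x)" for x
      have bdd: "bdd_below ((\<lambda>q. q x) ` c)" for x
        using bound cS by (intro bdd_belowI[where m = "- p (- x)"]) auto
      have upper: "u x \<le> q x" if "q \<in> c" for q x
        unfolding u_def using that bdd by (intro cINF_lower)
      have great: "z \<le> u x" if "\<And>q. q \<in> c \<Longrightarrow> z \<le> q x" for z x
        unfolding u_def using that False by (intro cINF_greatest)
      have "u (x + y) \<le> u x + u y" for x y
      proof -
        have "u (x + y) \<le> q x + r y" if "q \<in> c" "r \<in> c" for q r
        proof -
          have sub: "u (x + y) \<le> w x + w y" if "w \<in> c" for w
            using upper[OF that, of "x + y"] sublinear_add[of w x y] that cS by (force simp: S_def)
          from tot[OF that] show ?thesis
            using sub[OF that(1)] sub[OF that(2)] unfolding R_def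
            by (smt (verit))
        qed
        then have "u (x + y) - r y \<le> u x" if "r \<in> c" for r
          using that by (intro great) (simp add: algebra_simps)
        then have "u (x + y) - u x \<le> u y"
          by (intro great) (simp add: algebra_simps)
        then show ?thesis by simp
      qed
      moreover have "u (t *\<^sub>R x) = t * u x" if "0 \<le> t" for t x
      proof -
        have sc: "q (t *\<^sub>R x) = t * q x" if "q \<in> c" for q
          using that cS \<open>0 \<le> t\<close> by (auto simp: S_def intro: sublinear_scale)
        show ?thesis
        proof (cases "t = 0")
          case True
          have "(\<lambda>q. q (0::'a)) ` c = (\<lambda>q. 0) ` c"
            using sc True by (intro image_cong) auto
          then have "(\<lambda>q. q (0::'a)) ` c = {0}"
            using \<open>c \<noteq> {}\<close> by (simp add: image_constant_conv)
          then show ?thesis using True by (simp add: u_def)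
        next
          case False
          then have "0 < t" using that by simp
          have "u (t *\<^sub>R x) \<le> t * q x" if "q \<in> c" for q
            using upper[OF that] sc[OF that] by metis
          then have "u (t *\<^sub>R x) / t \<le> u x"
            using \<open>0 < t\<close> by (intro great) (simp add: field_simps)
          moreover have "t * u x \<le> u (t *\<^sub>R x)"
          proof (rule great)
            fix q assume "q \<in> c"
            then show "t * u x \<le> q (t *\<^sub>R x)"
              using sc[of q] upper[of q x] \<open>0 < t\<close> by (simp add: mult_left_mono)
          qed
          ultimately show ?thesis using \<open>0 < t\<close> by (simp add: field_simps)
        qed
      qed
      ultimately have "sublinear u"
        by (simp add: sublinear_def)
      moreover have "u x \<le> p x" for x
        using False upper cS unfolding S_def by (metis (no_types, lifting) all_not_in_conv mem_Collect_eq order_trans subsetD)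
      ultimately have "u \<in> S" by (simp add: S_def)
      then show ?thesis using upper by (auto simp: R_def)
    qed
  qed
  then obtain f where "f \<in> S" and f: "\<And>a. a \<in> S \<Longrightarrow> R f a \<Longrightarrow> a = f" by blast
  show ?thesis
  proof
    show "sublinear f" "f x \<le> p x" for x using \<open>f \<in> S\<close> by (auto simp: S_def)
    show "q x = f x" if q: "sublinear q" "\<And>x. q x \<le> f x" for q x
    proof -
      have "q \<in> S" using q \<open>f \<in> S\<close> by (auto simp: S_def intro: order_trans)
      then have "q = f" using f q(2) by (simp add: R_def)
      then show ?thesis by simp
    qed
  qed
qed

text \<open>A minimal sublinear functional is linear, since it coincides with each of its lowerings along directions
  \<open>x\<close>. Starting from \<open>p\<close> lowered along \<open>x0\<close> makes the value at \<open>x0\<close> as large as \<open>p\<close> allows. No extension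
  from subspaces is involved.\<close>

theorem hahn_banach_sublinear:
  fixes p :: "'a::real_vector \<Rightarrow> real"
  assumes p: "sublinear p"
  obtains f where "linear f" "\<And>x. f x \<le> p x" "f x0 = p x0"
proof -
  obtain f where f: "sublinear f" "\<And>x. f x \<le> lower_along p x0 x"
    and min: "\<And>q x. sublinear q \<Longrightarrow> (\<And>x. q x \<le> f x) \<Longrightarrow> q x = f x"
    using minimal_sublinear_exists[OF sublinear_lower_along[OF p]] by blast
  have add: "f (y + x) = f y + f x" for x y
  proof -
    have "lower_along f x y = f y"
      using sublinear_lower_along[OF f(1)] lower_along_le[OF f(1)] by (intro min)
    then have "f y \<le> f (y + x) - f x"
      using lower_along_le_diff[OF f(1), of x y] by simp
    then show ?thesis using sublinear_add[OF f(1), of y x] by simp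
  qed
  have neg: "f (- x) = - f x" for x
    using add[of x "- x"] sublinear_0[OF f(1)] by simp
  have "linear f"
  proof (rule linearI)
    show "f (t *\<^sub>R x) = t *\<^sub>R f x" for t x
    proof (cases "0 \<le> t")
      case True
      then show ?thesis using sublinear_scale[OF f(1)] by simp
    next
      case False
      then show ?thesis
        using sublinear_scale[OF f(1), of "- t" x] neg[of "t *\<^sub>R x"] by simp
    qed
  qed (simp add: add)
  moreover have "f x \<le> p x" for x using f(2) lower_along_le[OF p] order_trans by blast
  moreover have "f x0 = p x0"
    using f(2)[of "- x0"] lower_along_le_diff[OF p, of x0 "- x0"] neg[of x0] sublinear_0[OF p] calculation(2)[of x0] by simp
  ultimately show ?thesis using that by blast
qed

section \<open>Gauges, seminorms and separation of convex sets\<close>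

lemma continuous_on_scaleR_tvs:
  fixes x :: "'a::topological_vector_space"
  shows "continuous_on UNIV (\<lambda>c. c *\<^sub>R x)" and "continuous_on UNIV (\<lambda>y::'a. c *\<^sub>R y)"
proof -
  have "((\<lambda>c. c *\<^sub>R x) \<longlongrightarrow> c *\<^sub>R x) (nhds c)" for c
  proof -
    have "filterlim (\<lambda>c. (c, x)) (nhds c \<times>\<^sub>F nhds x) (nhds c)"
      by (intro filterlim_Pair filterlim_ident tendsto_const)
    from filterlim_compose[OF tendsto_scaleR_Pair this] show ?thesis by simp
  qed
  then show "continuous_on UNIV (\<lambda>c. c *\<^sub>R x)"
    by (auto simp: continuous_on_def intro: filterlim_mono at_within_le_nhds)
  have "((\<lambda>y. c *\<^sub>R y) \<longlongrightarrow> c *\<^sub>R y) (nhds y)" for y :: 'a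
  proof -
    have "filterlim (\<lambda>y. (c, y)) (nhds c \<times>\<^sub>F nhds y) (nhds y)"
      by (intro filterlim_Pair filterlim_ident tendsto_const)
    from filterlim_compose[OF tendsto_scaleR_Pair this] show ?thesis by simp
  qed
  then show "continuous_on UNIV (\<lambda>y::'a. c *\<^sub>R y)"
    by (auto simp: continuous_on_def intro: filterlim_mono at_within_le_nhds)
qed

lemma continuous_on_sum_tvs:
  fixes T :: "'i \<Rightarrow> 'b::topological_space \<Rightarrow> 'a::topological_vector_space"
  assumes "\<And>i. i \<in> F \<Longrightarrow> continuous_on A (T i)"
  shows "continuous_on A (\<lambda>x. \<Sum>i\<in>F. T i x)"
  using assms by (induction F rule: infinite_finite_induct) (auto intro: continuous_on_add)

lemma open_vimage_UNIV: "continuous_on UNIV f \<Longrightarrow> open U \<Longrightarrow> open (f -` U)"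
  using open_vimage by blast

lemma nhd_zero_absorbs:
  fixes x :: "'a::topological_vector_space"
  assumes "open W" "0 \<in> W"
  obtains t where "0 < t" "t *\<^sub>R x \<in> W"
proof -
  have "open ((\<lambda>c. c *\<^sub>R x) -` W)"
    by (intro open_vimage_UNIV continuous_on_scaleR_tvs assms)
  moreover have "0 \<in> (\<lambda>c. c *\<^sub>R x) -` W" using assms by simp
  ultimately obtain e where e: "e > 0" "ball 0 e \<subseteq> (\<lambda>c. c *\<^sub>R x) -` W"
    by (meson open_contains_ball)
  then have "e / 2 \<in> (\<lambda>c. c *\<^sub>R x) -` W" by (intro subsetD[OF e(2)]) auto
  then show ?thesis using that[of "e / 2"] e(1) by simp
qed

text \<open>A bound on one neighbourhood of zero suffices, because
  \<open>q z - q x \<le> q (z - x)\<close> and \<open>q x - q z \<le> q (x - z)\<close> reduce continuity everywhere to continuity at zero.\<close>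

lemma sublinear_continuous:
  fixes q :: "'a::topological_vector_space \<Rightarrow> real"
  assumes q: "sublinear q" and W: "open W" "0 \<in> W" "\<And>x. x \<in> W \<Longrightarrow> q x \<le> 1"
  shows "continuous_on UNIV q"
  unfolding continuous_on_def
proof (intro ballI tendstoI)
  fix x and e :: real assume "0 < e"
  define N where "N = (\<lambda>z. (2 / e) *\<^sub>R (z - x)) -` W \<inter> (\<lambda>z. (2 / e) *\<^sub>R (x - z)) -` W"
  have "open N"
    unfolding N_def
  proof (intro open_Int open_vimage_UNIV W(1))
    have "continuous_on UNIV (\<lambda>z. z - x)" "continuous_on UNIV (\<lambda>z. x - z)"
      by (auto intro: continuous_intros)
    then show "continuous_on UNIV (\<lambda>z. (2 / e) *\<^sub>R (z - x))" "continuous_on UNIV (\<lambda>z. (2 / e) *\<^sub>R (x - z))"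
      by (auto intro: continuous_on_compose2[OF continuous_on_scaleR_tvs(2)])
  qed
  moreover have "x \<in> N" using W by (simp add: N_def)
  moreover have "dist (q z) (q x) < e" if "z \<in> N" for z
  proof -
    have "q ((2 / e) *\<^sub>R (z - x)) \<le> 1" "q ((2 / e) *\<^sub>R (x - z)) \<le> 1"
      using that by (auto simp: N_def intro: W(3))
    then have "q (z - x) \<le> e / 2" "q (x - z) \<le> e / 2"
      unfolding sublinear_scale[OF q less_imp_le[OF divide_pos_pos[OF zero_less_numeral \<open>0 < e\<close>]]]
      using \<open>0 < e\<close> by (simp_all add: field_simps)
    moreover have "q z \<le> q (z - x) + q x" "q x \<le> q (x - z) + q z"
      using sublinear_add[OF q, of "z - x" x] sublinear_add[OF q, of "x - z" z] by simp_all
    ultimately show ?thesis using \<open>0 < e\<close> by (simp add: dist_real_def)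
  qed
  ultimately show "\<forall>\<^sub>F z in at x within UNIV. dist (q z) (q x) < e"
    by (metis (mono_tags, lifting) eventually_at_topological)
qed

text \<open>The Minkowski functional. The infimum is meaningful when zero is interior to \<open>V\<close>, for then the set is nonempty.\<close>

definition gauge_of :: "'a::real_vector set \<Rightarrow> 'a \<Rightarrow> real" where
  "gauge_of V x = Inf {t. 0 < t \<and> (1 / t) *\<^sub>R x \<in> V}"

lemma gauge_of:
  fixes V :: "'a::topological_vector_space set"
  assumes V: "convex V" "0 \<in> interior V"
  shows sublinear_gauge_of: "sublinear (gauge_of V)"
    and gauge_of_le: "x \<in> V \<Longrightarrow> gauge_of V x \<le> 1"
    and gauge_of_less: "gauge_of V x < 1 \<Longrightarrow> x \<in> V"
proof -
  have bdd: "bdd_below {t. 0 < t \<and> (1 / t) *\<^sub>R x \<in> V}" for x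
    by (intro bdd_belowI[of _ 0]) auto
  have ne: "{t. 0 < t \<and> (1 / t) *\<^sub>R x \<in> V} \<noteq> {}" for x
  proof -
    obtain t where "0 < t" "t *\<^sub>R x \<in> interior V"
      using nhd_zero_absorbs[OF open_interior V(2)] by blast
    then have "1 / t \<in> {t. 0 < t \<and> (1 / t) *\<^sub>R x \<in> V}"
      using interior_subset by auto
    then show ?thesis by blast
  qed
  have upper: "gauge_of V x \<le> t" if "0 < t" "(1 / t) *\<^sub>R x \<in> V" for t x
    unfolding gauge_of_def using that by (intro cInf_lower bdd) auto
  have great: "z \<le> gauge_of V x" if "\<And>t. 0 < t \<Longrightarrow> (1 / t) *\<^sub>R x \<in> V \<Longrightarrow> z \<le> t" for z x
    unfolding gauge_of_def using that by (intro cInf_greatest ne) auto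
  have V0: "0 \<in> V" using V(2) interior_subset by blast
  have comb: "u *\<^sub>R a + v *\<^sub>R b \<in> V" if "a \<in> V" "b \<in> V" "0 \<le> u" "0 \<le> v" "u + v = 1" for a b u v
    using V(1) that unfolding convex_def by blast
  show "x \<in> V \<Longrightarrow> gauge_of V x \<le> 1" for x
    using upper[of 1 x] by simp
  show "x \<in> V" if "gauge_of V x < 1" for x
  proof -
    have "\<exists>t\<in>{t. 0 < t \<and> (1 / t) *\<^sub>R x \<in> V}. t < 1"
      using that cInf_less_iff[OF ne bdd, of x 1] by (simp add: gauge_of_def)
    then obtain t where t: "0 < t" "(1 / t) *\<^sub>R x \<in> V" "t < 1" by blast
    show ?thesis
      using comb[OF t(2) V0, of t "1 - t"] t by simp
  qed
  have "gauge_of V (x + y) \<le> gauge_of V x + gauge_of V y" for x y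
  proof -
    have *: "gauge_of V (x + y) \<le> s + t"
      if "0 < s" "(1 / s) *\<^sub>R x \<in> V" "0 < t" "(1 / t) *\<^sub>R y \<in> V" for s t
    proof (rule upper)
      have "(s / (s + t)) *\<^sub>R ((1 / s) *\<^sub>R x) + (t / (s + t)) *\<^sub>R ((1 / t) *\<^sub>R y) \<in> V"
        using that by (intro comb) (auto simp: add_divide_distrib[symmetric])
      moreover have "(s / (s + t)) *\<^sub>R ((1 / s) *\<^sub>R x) + (t / (s + t)) *\<^sub>R ((1 / t) *\<^sub>R y) = (1 / (s + t)) *\<^sub>R (x + y)"
        using that by (simp add: scaleR_add_right)
      ultimately show "(1 / (s + t)) *\<^sub>R (x + y) \<in> V" by simp
    qed (use that in auto)
    have "gauge_of V (x + y) - t \<le> gauge_of V x" if "0 < t" "(1 / t) *\<^sub>R y \<in> V" for t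
      using * that by (intro great) (simp add: algebra_simps)
    then have "gauge_of V (x + y) - gauge_of V x \<le> gauge_of V y"
      by (intro great) (simp add: algebra_simps)
    then show ?thesis by simp
  qed
  moreover have le: "gauge_of V (s *\<^sub>R x) \<le> s * gauge_of V x" if "0 < s" for s x
  proof -
    have "gauge_of V (s *\<^sub>R x) / s \<le> t" if "0 < t" "(1 / t) *\<^sub>R x \<in> V" for t
      using upper[of "s * t" "s *\<^sub>R x"] that \<open>0 < s\<close> by (simp add: field_simps)
    then have "gauge_of V (s *\<^sub>R x) / s \<le> gauge_of V x" by (rule great)
    then show ?thesis using that by (simp add: field_simps)
  qed
  have g0: "gauge_of V 0 = 0"
  proof (rule antisym)
    show "gauge_of V 0 \<le> 0"
    proof (rule field_le_epsilon)
      fix e :: real assume "0 < e"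
      then show "gauge_of V 0 \<le> 0 + e" using upper[of e 0] V0 by simp
    qed
    show "0 \<le> gauge_of V 0" by (rule great) simp
  qed
  have "gauge_of V (s *\<^sub>R x) = s * gauge_of V x" if "0 \<le> s" for s x
  proof (cases "s = 0")
    case False
    then have "0 < s" using that by simp
    moreover have "s * gauge_of V x \<le> gauge_of V (s *\<^sub>R x)"
      using le[of "1 / s" "s *\<^sub>R x"] \<open>0 < s\<close> by (simp add: field_simps)
    ultimately show ?thesis using le[of s x] by simp
  qed (simp add: g0)
  ultimately show "sublinear (gauge_of V)"
    by (simp add: sublinear_def)
qed

definition continuous_seminorm :: "('a::topological_vector_space \<Rightarrow> real) \<Rightarrow> bool" where
  "continuous_seminorm p \<longleftrightarrow> sublinear p \<and> (\<forall>x. p (- x) = p x) \<and> continuous_on UNIV p"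

lemma continuous_seminormD:
  assumes "continuous_seminorm p"
  shows "sublinear p" "p (- x) = p x" "continuous_on UNIV p"
    "p (x + y) \<le> p x + p y" "0 \<le> t \<Longrightarrow> p (t *\<^sub>R x) = t * p x" "p 0 = 0" "0 \<le> p x"
    "p (x - y) = p (y - x)" "p (x - y) \<le> p x + p y"
proof -
  show p: "sublinear p" and m: "p (- x) = p x" and "continuous_on UNIV p" for x
    using assms by (auto simp: continuous_seminorm_def)
  show add: "p (x + y) \<le> p x + p y" for x y using p by (rule sublinear_add)
  show "p (t *\<^sub>R x) = t * p x" if "0 \<le> t" using p that by (rule sublinear_scale)
  show p0: "p 0 = 0" using p by (rule sublinear_0)
  show "0 \<le> p x" using add[of x "- x"] m[of x] p0 by simp
  show "p (x - y) = p (y - x)" using m[of "x - y"] by simp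
  show "p (x - y) \<le> p x + p y" using add[of x "- y"] m[of y] by simp
qed

lemma continuous_seminorm_scaleR:
  assumes "continuous_seminorm p"
  shows "p (c *\<^sub>R x) = \<bar>c\<bar> * p x"
proof (cases "0 \<le> c")
  case True
  then show ?thesis using continuous_seminormD(5)[OF assms] by simp
next
  case False
  then have "p ((- c) *\<^sub>R x) = \<bar>c\<bar> * p x" using continuous_seminormD(5)[OF assms, of "- c" x] by simp
  then show ?thesis using continuous_seminormD(2)[OF assms, of "c *\<^sub>R x"] by simp
qed

lemma continuous_seminorm_sum:
  assumes "finite I" "\<And>i. i \<in> I \<Longrightarrow> continuous_seminorm (p i)"
  shows "continuous_seminorm (\<lambda>x. \<Sum>i\<in>I. p i x)"
  unfolding continuous_seminorm_def sublinear_def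
proof (intro conjI allI impI)
  show "(\<Sum>i\<in>I. p i (x + y)) \<le> (\<Sum>i\<in>I. p i x) + (\<Sum>i\<in>I. p i y)" for x y
    unfolding sum.distrib[symmetric] using assms(2) continuous_seminormD(4) by (intro sum_mono) blast
  show "(\<Sum>i\<in>I. p i (t *\<^sub>R x)) = t * (\<Sum>i\<in>I. p i x)" if "0 \<le> t" for t x
    unfolding sum_distrib_left using assms(2) continuous_seminormD(5) that by (intro sum.cong) blast+
  show "(\<Sum>i\<in>I. p i (- x)) = (\<Sum>i\<in>I. p i x)" for x
    using assms(2) continuous_seminormD(2) by (intro sum.cong) blast+
  show "continuous_on UNIV (\<lambda>x. \<Sum>i\<in>I. p i x)"
    using assms(2) continuous_seminormD(3) by (intro continuous_on_sum) blast
qed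

text \<open>The gauge of a convex neighbourhood need not be symmetric; the maximum of its values at \<open>x\<close> and \<open>- x\<close> is.\<close>

lemma seminorm_in_nhd_zero:
  fixes U :: "'a::locally_convex_space set"
  assumes "open U" "0 \<in> U"
  obtains p where "continuous_seminorm p" "\<And>x. p x < 1 \<Longrightarrow> x \<in> U"
proof -
  obtain V where V: "convex V" "0 \<in> interior V" "V \<subseteq> U"
    using convex_nhds_zero_base[OF assms] by blast
  let ?g = "gauge_of V"
  define p where "p x = max (?g x) (?g (- x))" for x
  note g = sublinear_gauge_of[OF V(1,2)]
  have "sublinear p"
    unfolding sublinear_def
  proof safe
    show "p (x + y) \<le> p x + p y" for x y
    proof -
      have "?g (- (x + y)) \<le> ?g (- x) + ?g (- y)"
        using sublinear_add[OF g, of "- x" "- y"] by simp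
      then show ?thesis
        using sublinear_add[OF g, of x y] unfolding p_def by linarith
    qed
    show "p (t *\<^sub>R x) = t * p x" if "0 \<le> t" for t x
      using sublinear_scale[OF g that, of x] sublinear_scale[OF g that, of "- x"] that
      by (simp add: p_def max_mult_distrib_left)
  qed
  moreover have "continuous_on UNIV p"
  proof (rule sublinear_continuous[OF calculation])
    let ?W = "interior V \<inter> uminus -` interior V"
    show "open ?W" by (intro open_Int open_interior open_vimage_UNIV continuous_intros)
    show "0 \<in> ?W" using V(2) by simp
    show "p x \<le> 1" if "x \<in> ?W" for x
      using that gauge_of_le[OF V(1,2), of x] gauge_of_le[OF V(1,2), of "- x"] interior_subset
      by (auto simp: p_def)
  qed
  ultimately have "continuous_seminorm p"
    by (simp add: continuous_seminorm_def p_def max.commute)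
  moreover have "x \<in> U" if "p x < 1" for x
    using that gauge_of_less[OF V(1,2)] V(3) by (auto simp: p_def)
  ultimately show ?thesis using that by blast
qed

lemma not_in_closure_seminorm:
  fixes A :: "'a::locally_convex_space set"
  assumes "0 \<notin> closure A"
  obtains p where "continuous_seminorm p" "\<And>a. a \<in> A \<Longrightarrow> 1 \<le> p a"
proof -
  obtain p where p: "continuous_seminorm p" "\<And>x. p x < 1 \<Longrightarrow> x \<in> - closure A"
    using seminorm_in_nhd_zero[of "- closure A"] assms by auto
  moreover have "1 \<le> p a" if "a \<in> A" for a
    using p(2)[of a] that closure_subset[of A] by force
  ultimately show ?thesis using that by blast
qed

text \<open>Convexity is assumed as an explicit inequality so that seminorms and their sums with functionals fit directly.\<close>

lemma closed_convex_sublevel: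
  fixes \<Phi> :: "'a::topological_vector_space \<Rightarrow> real"
  assumes "continuous_on UNIV \<Phi>"
    and "\<And>x y u v. 0 \<le> u \<Longrightarrow> 0 \<le> v \<Longrightarrow> u + v = 1 \<Longrightarrow> \<Phi> (u *\<^sub>R x + v *\<^sub>R y) \<le> u * \<Phi> x + v * \<Phi> y"
  shows "convex {x. \<Phi> x \<le> \<beta>}" "closed {x. \<Phi> x \<le> \<beta>}"
proof -
  show "convex {x. \<Phi> x \<le> \<beta>}"
    unfolding convex_def
  proof clarify
    fix x y u v assume *: "\<Phi> x \<le> \<beta>" "\<Phi> y \<le> \<beta>" "0 \<le> u" "0 \<le> v" "u + v = (1::real)"
    have "\<Phi> (u *\<^sub>R x + v *\<^sub>R y) \<le> u * \<Phi> x + v * \<Phi> y" using * assms(2) by blast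
    also have "\<dots> \<le> u * \<beta> + v * \<beta>" using * by (intro add_mono mult_left_mono)
    also have "\<dots> = \<beta>" using * by (simp add: distrib_right[symmetric])
    finally show "\<Phi> (u *\<^sub>R x + v *\<^sub>R y) \<le> \<beta>" .
  qed
  show "closed {x. \<Phi> x \<le> \<beta>}"
    using assms(1) by (intro closed_Collect_le) auto
qed

lemma seminorm_dist_convex:
  assumes "continuous_seminorm p" "0 \<le> u" "0 \<le> v" "u + v = (1::real)"
  shows "p (u *\<^sub>R x + v *\<^sub>R y - d) \<le> u * p (x - d) + v * p (y - d)"
proof -
  have "d = u *\<^sub>R d + v *\<^sub>R d" using assms(4) by (simp add: scaleR_add_left[symmetric])
  then have "u *\<^sub>R x + v *\<^sub>R y - d = u *\<^sub>R (x - d) + v *\<^sub>R (y - d)"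
    by (simp add: algebra_simps)
  then show ?thesis
    using continuous_seminormD(4)[OF assms(1), of "u *\<^sub>R (x - d)" "v *\<^sub>R (y - d)"]
      continuous_seminormD(5)[OF assms(1)] assms(2,3) by simp
qed

lemma continuous_on_seminorm_dist:
  assumes "continuous_seminorm p"
  shows "continuous_on UNIV (\<lambda>x. p (x - d))"
  using continuous_seminormD(3)[OF assms]
  by (rule continuous_on_compose2) (auto intro: continuous_intros)

text \<open>Enlarge \<open>A\<close>, translated by one of its points, by a small convex neighbourhood \<open>V\<close> of zero that keeps the
  translate of \<open>q\<close> outside. The Hahn-Banach theorem for the gauge of the enlarged set yields a functional that is largest at \<open>q\<close>;
  the room given by \<open>V\<close> provides both its continuity and the gap \<open>\<delta>\<close>.\<close>

theorem separate_point_closed_convex: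
  fixes A :: "'a::locally_convex_space set"
  assumes A: "convex A" "closed A" and q: "q \<notin> A"
  obtains f \<delta> where "f \<in> topological_dual" "0 < \<delta>" "\<And>a. a \<in> A \<Longrightarrow> f a + \<delta> \<le> f q"
proof (cases "A = {}")
  case True
  have "(\<lambda>x::'a. 0::real) \<in> topological_dual"
    by (simp add: topological_dual_def linear_iff)
  from that[OF this, of 1] show ?thesis using True by simp
next
  case False
  then obtain a0 where a0: "a0 \<in> A" by blast
  have "open ((\<lambda>v. q - v) -` (- A))"
    using A(2) by (intro open_vimage_UNIV continuous_intros) auto
  then obtain V where V: "convex V" "0 \<in> interior V" "V \<subseteq> (\<lambda>v. q - v) -` (- A)"
    using convex_nhds_zero_base[of "(\<lambda>v. q - v) -` (- A)"] q by auto
  define U where "U = (\<Union>a\<in>A. \<Union>v\<in>V. {(a - a0) + v})"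
  have "U = (\<Union>x\<in>(\<lambda>a. a - a0) ` A. \<Union>y\<in>V. {x + y})"
    by (auto simp: U_def)
  then have "convex U"
    using convex_sums[OF convex_translation_subtract[OF A(1), of a0] V(1)] by (auto simp: U_def)
  have "V \<subseteq> U" using a0 by (force simp: U_def)
  then have 0: "0 \<in> interior U" using V(2) interior_mono by blast
  have qU: "q - a0 \<notin> U"
  proof
    assume "q - a0 \<in> U"
    then obtain a v where "a \<in> A" "v \<in> V" "q - a0 = (a - a0) + v" by (auto simp: U_def)
    then have "q - v = a" by (simp add: algebra_simps)
    then show False using V(3) \<open>a \<in> A\<close> \<open>v \<in> V\<close> by auto
  qed
  note g = gauge_of[OF \<open>convex U\<close> 0]
  obtain f where f: "linear f" "\<And>x. f x \<le> gauge_of U x" "f (q - a0) = gauge_of U (q - a0)"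
    using hahn_banach_sublinear[OF g(1)] by blast
  have fU: "f x \<le> 1" if "x \<in> U" for x using f(2)[of x] g(2)[OF that] by simp
  have fq: "1 \<le> f (q - a0)" using f(3) g(3)[of "q - a0"] qU by force
  have "continuous_on UNIV f"
    using 0 fU interior_subset by (intro sublinear_continuous[OF linear_sublinear[OF f(1)] open_interior]) auto
  moreover obtain t where t: "0 < t" "t *\<^sub>R (q - a0) \<in> interior V"
    using nhd_zero_absorbs[OF open_interior V(2)] by blast
  moreover have "f a + t * f (q - a0) \<le> f q" if "a \<in> A" for a
  proof -
    have "(a - a0) + t *\<^sub>R (q - a0) \<in> U"
      using that t(2) interior_subset by (fastforce simp: U_def)
    from fU[OF this] fq show ?thesis
      using f(1) by (simp add: linear_add linear_diff linear_scale)
  qed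
  ultimately show ?thesis
    using that[of f "t * f (q - a0)"] f(1) fq by (simp add: topological_dual_def)
qed

section \<open>The weak topology\<close>

lemma topological_dualD:
  assumes "f \<in> topological_dual"
  shows "linear f" "continuous_on UNIV f" "f (x + y) = f x + f y" "f (x - y) = f x - f y"
    "f (c *\<^sub>R x) = c * f x" "f 0 = 0"
  using assms by (auto simp: topological_dual_def linear_add linear_diff linear_scale linear_0)

lemma topological_dual_uminus: "f \<in> topological_dual \<Longrightarrow> (\<lambda>x. - f x) \<in> topological_dual"
  by (auto simp: topological_dual_def linear_iff intro!: continuous_intros)

lemma topological_dual_scale: "f \<in> topological_dual \<Longrightarrow> (\<lambda>x. c * f x) \<in> topological_dual"
  by (auto simp: topological_dual_def linear_iff distrib_left intro!: continuous_intros)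

lemma topological_dual_diff:
  "f \<in> topological_dual \<Longrightarrow> g \<in> topological_dual \<Longrightarrow> (\<lambda>x. f x - g x) \<in> topological_dual"
  by (auto simp: topological_dual_def linear_iff right_diff_distrib intro!: continuous_intros)

lemma topological_dual_compose:
  assumes "f \<in> topological_dual" "linear T" "continuous_on UNIV T"
  shows "(\<lambda>x. f (T x)) \<in> topological_dual"
  using assms linear_compose[OF assms(2), of f] continuous_on_compose2[of UNIV f UNIV T]
  by (simp add: topological_dual_def o_def)

lemma topspace_weak_topology [simp]: "topspace weak_topology = UNIV"
proof -
  have "(\<lambda>x::'a. 0::real) \<in> topological_dual"
    by (simp add: topological_dual_def linear_iff)
  then have "\<exists>X. (\<exists>f U. X = f -` U \<and> f \<in> topological_dual \<and> open U) \<and> x \<in> X" for x :: 'a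
    by (intro exI[of _ "(\<lambda>x::'a. 0::real) -` UNIV"]) auto
  then show ?thesis
    unfolding weak_topology_def topology_generated_by_topspace by auto
qed

lemma continuous_map_weak_dual:
  assumes "f \<in> topological_dual"
  shows "continuous_map weak_topology euclideanreal f"
proof -
  have "openin weak_topology (f -` U)" if "open U" for U
    unfolding weak_topology_def using assms that by (intro topology_generated_by_Basis) blast
  then show ?thesis by (auto simp: continuous_map_def vimage_def)
qed

text \<open>The weak topology is initial for the dual, so weak continuity is tested on functionals.\<close>

lemma continuous_map_into_weak:
  fixes g :: "'b \<Rightarrow> 'a::topological_vector_space"
  assumes "\<And>f. f \<in> topological_dual \<Longrightarrow> continuous_map X euclideanreal (\<lambda>x. f (g x))"
  shows "continuous_map X weak_topology g"
  unfolding weak_topology_def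
proof (rule continuous_on_generated_topo)
  fix U :: "'a set" assume "U \<in> {f -` U |f U. f \<in> topological_dual \<and> open U}"
  then obtain f V where f: "U = f -` V" "f \<in> topological_dual" "open V" by blast
  have "openin X {x \<in> topspace X. f (g x) \<in> V}"
    using assms[OF f(2)] f(3) by (simp add: continuous_map_def)
  also have "{x \<in> topspace X. f (g x) \<in> V} = g -` U \<inter> topspace X"
    using f(1) by auto
  finally show "openin X (g -` U \<inter> topspace X)" .
next
  show "g ` topspace X \<subseteq> \<Union> {f -` U |f U. f \<in> topological_dual \<and> open U}"
    using topspace_weak_topology[where 'a = 'a] unfolding weak_topology_def topology_generated_by_topspace
    by (simp only: subset_UNIV)
qed

lemma continuous_map_weak_linear:
  assumes "linear T" "continuous_on UNIV T"
  shows "continuous_map weak_topology weak_topology T"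
  using topological_dual_compose[OF _ assms]
  by (intro continuous_map_into_weak continuous_map_weak_dual)

lemma openin_weak_imp_open:
  assumes "openin weak_topology U"
  shows "open U"
proof -
  have "generate_topology_on {f -` U |f U. f \<in> topological_dual \<and> open U} U"
    using assms unfolding weak_topology_def by (rule openin_topology_generated_by)
  then show ?thesis
    by induction (auto intro: open_vimage simp: topological_dual_def)
qed

lemma closedin_weak_imp_closed: "closedin weak_topology A \<Longrightarrow> closed A"
  using openin_weak_imp_open[of "- A"] by (simp add: closedin_def Compl_eq_Diff_UNIV closed_def)

lemma closedin_weak_sublevel:
  assumes "f \<in> topological_dual"
  shows "closedin weak_topology {x. f x \<le> \<beta>}"
  using closedin_continuous_map_preimage[OF continuous_map_weak_dual[OF assms], of "{..\<beta>}"] by simp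

lemma closedin_weak_halfspaces:
  assumes "\<And>i. i \<in> I \<Longrightarrow> f i \<in> topological_dual"
  shows "closedin weak_topology {x::'a::topological_vector_space. \<forall>i\<in>I. f i x \<le> b i}"
proof -
  have "closedin weak_topology (\<Inter>(insert UNIV ((\<lambda>i. {x. f i x \<le> b i}) ` I)))"
    using closedin_topspace[of "weak_topology :: 'a topology"]
    by (intro closedin_Inter) (auto intro: closedin_weak_sublevel assms)
  also have "\<Inter>(insert UNIV ((\<lambda>i. {x. f i x \<le> b i}) ` I)) = {x. \<forall>i\<in>I. f i x \<le> b i}"
    by auto
  finally show ?thesis .
qed

lemma convex_halfspaces:
  assumes "\<And>i. i \<in> I \<Longrightarrow> linear (f i :: 'a::real_vector \<Rightarrow> real)"
  shows "convex {x. \<forall>i\<in>I. f i x \<le> b i}"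
  unfolding convex_def
proof safe
  fix x y u v i
  assume *: "\<forall>i\<in>I. f i x \<le> b i" "\<forall>i\<in>I. f i y \<le> b i" "0 \<le> u" "0 \<le> v" "u + v = (1::real)" "i \<in> I"
  have "u * f i x + v * f i y \<le> u * b i + v * b i"
    using * by (intro add_mono mult_left_mono) auto
  then show "f i (u *\<^sub>R x + v *\<^sub>R y) \<le> b i"
    using assms[OF \<open>i \<in> I\<close>] \<open>u + v = 1\<close> by (simp add: linear_add linear_scale distrib_right[symmetric])
qed

text \<open>Mazur's theorem: by separation, a closed convex set is the intersection of the closed half-spaces that contain it.\<close>

lemma closedin_weak_closed_convex:
  fixes A :: "'a::locally_convex_space set"
  assumes "convex A" "closed A"
  shows "closedin weak_topology A"
proof -
  define H where "H = {{x. f x \<le> \<beta>} |f \<beta>. f \<in> topological_dual \<and> (\<forall>a\<in>A. f a \<le> \<beta>)}"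
  have "x \<in> A" if "x \<in> \<Inter>H" for x
  proof (rule ccontr)
    assume "x \<notin> A"
    then obtain f \<delta> where f: "f \<in> topological_dual" "0 < \<delta>" "\<And>a. a \<in> A \<Longrightarrow> f a + \<delta> \<le> f x"
      using separate_point_closed_convex[OF assms] by blast
    then have "{z. f z \<le> f x - \<delta>} \<in> H"
      unfolding H_def by force
    with that f(2) show False by force
  qed
  then have "A = \<Inter>(insert UNIV H)" by (auto simp: H_def)
  moreover have "closedin weak_topology (\<Inter>(insert UNIV H))"
    using closedin_topspace[of "weak_topology :: 'a topology"]
    by (intro closedin_Inter) (auto simp: H_def closedin_weak_sublevel)
  ultimately show ?thesis by simp
qed

text \<open>This is the link between the two topologies: balls of a seminorm have no reason to be weakly open, but they are
  weakly closed, so countable covers by them are accessible to the Baire category theorem in the weak topology.\<close>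

lemma closedin_weak_seminorm_ball:
  fixes p :: "'a::locally_convex_space \<Rightarrow> real"
  assumes "continuous_seminorm p"
  shows "closedin weak_topology {x. p (x - d) \<le> r}"
  using closed_convex_sublevel[OF continuous_on_seminorm_dist[OF assms] seminorm_dist_convex[OF assms]]
  by (intro closedin_weak_closed_convex)

lemma dual_separates_points:
  fixes x y :: "'a::{locally_convex_space, t2_space}"
  assumes "x \<noteq> y"
  obtains f where "f \<in> topological_dual" "f y < f x"
proof -
  obtain f \<delta> where "f \<in> topological_dual" "0 < \<delta>" "\<And>a. a \<in> {y} \<Longrightarrow> f a + \<delta> \<le> f x"
    using separate_point_closed_convex[of "{y}" x] assms by auto
  then show ?thesis using that[of f] by force
qed

lemma dual_eqI:
  fixes x y :: "'a::{locally_convex_space, t2_space}"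
  assumes "\<And>f. f \<in> topological_dual \<Longrightarrow> f x \<le> f y"
  shows "x = y"
  using dual_separates_points[of x y] assms by (metis not_less)

lemma Hausdorff_space_weak:
  "Hausdorff_space (weak_topology :: 'a::{locally_convex_space, t2_space} topology)"
  unfolding Hausdorff_space_def
proof clarify
  fix x y :: 'a assume "x \<noteq> y"
  then obtain f where f: "f \<in> topological_dual" "f y < f x"
    using dual_separates_points by blast
  define m where "m = (f x + f y) / 2"
  have "openin weak_topology {z. f z \<in> {m<..}}" "openin weak_topology {z. f z \<in> {..<m}}"
    using continuous_map_weak_dual[OF f(1)] unfolding continuous_map_def
    by (simp_all del: greaterThan_iff lessThan_iff)
  then show "\<exists>U V. openin weak_topology U \<and> openin weak_topology V \<and> x \<in> U \<and> y \<in> V \<and> disjnt U V"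
    using f(2) by (intro exI[of _ "{z. f z \<in> {m<..}}"] exI[of _ "{z. f z \<in> {..<m}}"])
      (auto simp: m_def disjnt_iff field_simps)
qed

lemma weak_topology_basis:
  assumes "openin weak_topology W" "x \<in> W"
  obtains F where "finite F" "F \<subseteq> topological_dual" "{z. \<forall>f\<in>F. \<bar>f z - f x\<bar> < 1} \<subseteq> W"
proof -
  have "generate_topology_on {f -` U |f U. f \<in> topological_dual \<and> open U} W"
    using assms(1) unfolding weak_topology_def by (rule openin_topology_generated_by)
  then have "x \<in> W \<Longrightarrow> \<exists>F. finite F \<and> F \<subseteq> topological_dual \<and> {z. \<forall>f\<in>F. \<bar>f z - f x\<bar> < 1} \<subseteq> W"
  proof induction
    case (Int a b)
    then obtain F F' where "finite F" "F \<subseteq> topological_dual" "{z. \<forall>f\<in>F. \<bar>f z - f x\<bar> < 1} \<subseteq> a"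
      "finite F'" "F' \<subseteq> topological_dual" "{z. \<forall>f\<in>F'. \<bar>f z - f x\<bar> < 1} \<subseteq> b"
      by auto
    then show ?case by (intro exI[of _ "F \<union> F'"]) auto
  next
    case (UN K)
    then obtain k where "k \<in> K" "x \<in> k" by auto
    with UN.IH[of k] show ?case by blast
  next
    case (Basis s)
    then obtain f U where f: "s = f -` U" "f \<in> topological_dual" "open U" by blast
    then obtain e where e: "e > 0" "ball (f x) e \<subseteq> U"
      using Basis.prems by (metis open_contains_ball vimage_eq)
    have "(\<lambda>z. (1 / e) * f z) \<in> topological_dual"
      using f(2) by (rule topological_dual_scale)
    moreover have "z \<in> s" if "\<bar>(1 / e) * f z - (1 / e) * f x\<bar> < 1" for z
    proof -
      have "\<bar>(1 / e) * f z - (1 / e) * f x\<bar> = \<bar>f z - f x\<bar> / e"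
        using e(1) by (simp add: diff_divide_distrib[symmetric])
      then have "f z \<in> ball (f x) e"
        using that e(1) by (simp add: dist_real_def abs_minus_commute)
      then show ?thesis using e(2) f(1) by auto
    qed
    ultimately show ?case
      by (intro exI[of _ "{\<lambda>z. (1 / e) * f z}"]) auto
  qed auto
  then show ?thesis using that assms(2) by blast
qed

section \<open>Weakly compact sets\<close>

lemma weakly_compact_dual_attains_sup:
  assumes "compactin weak_topology K" "K \<noteq> {}" "f \<in> topological_dual"
  obtains k where "k \<in> K" "\<And>x. x \<in> K \<Longrightarrow> f x \<le> f k"
proof -
  have "compact (f ` K)"
    using image_compactin[OF assms(1) continuous_map_weak_dual[OF assms(3)]] by simp
  then show ?thesis
    using compact_attains_sup[of "f ` K"] assms(2) that by blast
qed

lemma weakly_compact_dual_bounded: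
  assumes "compactin weak_topology K" "f \<in> topological_dual"
  obtains M where "\<And>x. x \<in> K \<Longrightarrow> \<bar>f x\<bar> \<le> M"
proof -
  have "compact (f ` K)"
    using image_compactin[OF assms(1) continuous_map_weak_dual[OF assms(2)]] by simp
  then have "bounded (f ` K)" by (rule compact_imp_bounded)
  then show ?thesis using that by (auto simp: bounded_iff)
qed

text \<open>A compact Hausdorff space is not a countable union of closed sets with empty interior.\<close>

lemma weakly_compact_Baire:
  fixes K :: "'a::{locally_convex_space, t2_space} set"
  assumes K: "compactin weak_topology K" "K \<noteq> {}" and D: "countable D"
    and B: "\<And>d. d \<in> D \<Longrightarrow> closedin weak_topology (B d)" and cov: "K \<subseteq> (\<Union>d\<in>D. B d)"
  obtains d W k where "d \<in> D" "openin weak_topology W" "k \<in> K" "k \<in> W" "K \<inter> W \<subseteq> B d"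
proof -
  let ?X = "subtopology weak_topology K"
  have "compact_space ?X" using K(1) by (simp add: compactin_subspace)
  moreover have "Hausdorff_space ?X"
    using Hausdorff_space_weak by (rule Hausdorff_space_subtopology)
  ultimately have X: "locally_compact_space ?X \<and> regular_space ?X"
    using compact_imp_locally_compact_space compact_Hausdorff_imp_regular_space by blast
  have eq: "\<Union> ((\<lambda>d. K \<inter> B d) ` D) = topspace ?X" using cov by auto
  have "?X interior_of (\<Union> ((\<lambda>d. K \<inter> B d) ` D)) \<noteq> {}"
    unfolding eq interior_of_topspace using K(2) by simp
  then obtain d where d: "d \<in> D" "?X interior_of (K \<inter> B d) \<noteq> {}"
    using Baire_category_alt[of ?X "(\<lambda>d. K \<inter> B d) ` D"] X D B
    by (metis (no_types, lifting) closedin_subtopology_Int_closed countable_image imageE)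
  have "openin ?X (?X interior_of (K \<inter> B d))" by simp
  then obtain W where W: "openin weak_topology W" "?X interior_of (K \<inter> B d) = W \<inter> K"
    unfolding openin_subtopology by blast
  moreover have "W \<inter> K \<subseteq> B d"
    using W(2) interior_of_subset[of ?X "K \<inter> B d"] by auto
  ultimately show ?thesis using that[of d W] d by blast
qed

text \<open>The Baire category theorem gives a weakly open \<open>W\<close> that meets \<open>K\<close> in a set on which \<open>p\<close> is bounded. Contracting \<open>K\<close> towards
  a point \<open>k0\<close> of that set moves all of \<open>K\<close> into \<open>W\<close>, since \<open>W\<close> restricts only finitely many functionals and
  these are bounded on \<open>K\<close>. The contraction changes \<open>p\<close> in a controlled way.\<close>

theorem seminorm_bounded_on_weakly_compact:
  fixes K :: "'a::{locally_convex_space, t2_space} set"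
  assumes K: "compactin weak_topology K" "convex K" and p: "continuous_seminorm p"
  obtains M where "0 < M" "\<And>x. x \<in> K \<Longrightarrow> p x \<le> M"
proof (cases "K = {}")
  case True
  then show ?thesis using that[of 1] by simp
next
  case False
  have "K \<subseteq> (\<Union>n::nat. {x. p (x - 0) \<le> real n})"
    by (auto intro: real_arch_simple)
  then obtain n :: nat and W k0 where W: "openin weak_topology W" "k0 \<in> K" "k0 \<in> W" "K \<inter> W \<subseteq> {x. p (x - 0) \<le> real n}"
    using weakly_compact_Baire[OF K(1) False, of "UNIV :: nat set" "\<lambda>n. {x. p (x - 0) \<le> real n}"]
      closedin_weak_seminorm_ball[OF p] by (metis countableI_type)
  obtain F where F: "finite F" "F \<subseteq> topological_dual" "{z. \<forall>f\<in>F. \<bar>f z - f k0\<bar> < 1} \<subseteq> W"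
    using weak_topology_basis[OF W(1,3)] by blast
  have "\<forall>f\<in>F. \<exists>M. \<forall>x\<in>K. \<bar>f x\<bar> \<le> M"
    using weakly_compact_dual_bounded[OF K(1)] F(2) by (metis subsetD)
  then obtain m where m: "\<And>f x. f \<in> F \<Longrightarrow> x \<in> K \<Longrightarrow> \<bar>f x\<bar> \<le> m f" by metis
  have m0: "0 \<le> m f" if "f \<in> F" for f using m[OF that W(2)] by linarith
  \<comment> \<open>With contraction factor \<open>1 / s\<close>, each of the finitely many functionals varies by less than 1.\<close>
  define s where "s = 1 + 2 * (\<Sum>f\<in>F. m f)"
  have s: "1 \<le> s" using m0 by (simp add: s_def sum_nonneg)
  have "p x \<le> s * (real n + p k0)" if "x \<in> K" for x
  proof -
    let ?z = "(1 - 1 / s) *\<^sub>R k0 + (1 / s) *\<^sub>R x"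
    have z: "?z \<in> K"
      using K(2) W(2) that s by (intro convexD) auto
    have "\<bar>f ?z - f k0\<bar> < 1" if f: "f \<in> F" for f
    proof -
      have "f \<in> topological_dual" using F(2) f by blast
      then have "f ?z - f k0 = (f x - f k0) / s"
        by (simp add: topological_dualD algebra_simps diff_divide_distrib)
      moreover have "m f \<le> (\<Sum>f\<in>F. m f)" using f F(1) m0 by (intro member_le_sum) auto
      then have "\<bar>f x - f k0\<bar> < s"
        using m[OF f W(2)] m[OF f \<open>x \<in> K\<close>] by (simp add: s_def)
      ultimately show ?thesis using s by (simp add: abs_divide)
    qed
    then have "?z \<in> W" using F(3) by blast
    then have zn: "p ?z \<le> real n" using W(4) z by auto
    have "(1 / s) * p x = p ((1 / s) *\<^sub>R x)"
      using s by (simp add: continuous_seminormD(5)[OF p])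
    also have "\<dots> = p (?z - (1 - 1 / s) *\<^sub>R k0)" by simp
    also have "\<dots> \<le> p ?z + p ((1 - 1 / s) *\<^sub>R k0)" by (rule continuous_seminormD(9)[OF p])
    also have "p ((1 - 1 / s) *\<^sub>R k0) = (1 - 1 / s) * p k0"
      using s by (intro continuous_seminormD(5)[OF p]) simp
    also have "\<dots> \<le> p k0"
      using s continuous_seminormD(7)[OF p, of k0] by (simp add: mult_left_le_one_le)
    finally have "(1 / s) * p x \<le> real n + p k0" using zn by simp
    then show ?thesis using s by (simp add: field_simps)
  qed
  moreover have "0 \<le> s * (real n + p k0)"
    using s continuous_seminormD(7)[OF p, of k0] by simp
  ultimately show ?thesis using that[of "s * (real n + p k0) + 1"] by fastforce
qed

lemma compactin_fipD:
  assumes "compactin X Q" and "\<And>U. U \<in> \<U> \<Longrightarrow> closedin X U"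
    and "\<And>\<F>. finite \<F> \<Longrightarrow> \<F> \<subseteq> \<U> \<Longrightarrow> Q \<inter> \<Inter>\<F> \<noteq> {}"
  shows "Q \<inter> \<Inter>\<U> \<noteq> {}"
  by (rule conjunct2[OF iffD1[OF compactin_fip assms(1)], THEN spec, THEN mp]) (use assms(2,3) in simp)

text \<open>Cantor's intersection theorem for chains: a nonempty finite subchain contains its own intersection.\<close>

lemma compactin_chain_Inter:
  assumes Q: "compactin X Q" and ne: "\<U> \<noteq> {}"
    and U: "\<And>U. U \<in> \<U> \<Longrightarrow> closedin X U \<and> U \<subseteq> Q \<and> U \<noteq> {}"
    and chain: "\<And>U V. U \<in> \<U> \<Longrightarrow> V \<in> \<U> \<Longrightarrow> U \<subseteq> V \<or> V \<subseteq> U"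
  shows "\<Inter>\<U> \<noteq> {}"
proof -
  have "Q \<inter> \<Inter>\<F> \<noteq> {}" if F: "finite \<F>" "\<F> \<subseteq> \<U>" for \<F>
  proof (cases "\<F> = {}")
    case True
    then show ?thesis using ne U by fastforce
  next
    case False
    then have "\<Inter>\<F> \<in> \<F>"
      using F chain by (intro Inter_in_chain[where \<A> = \<U>]) (auto simp: subset_chain_def)
    then show ?thesis using U F(2) by blast
  qed
  with U have "Q \<inter> \<Inter>\<U> \<noteq> {}"
    by (intro compactin_fipD[OF Q, of \<U>]) blast+
  then show ?thesis by blast
qed

section \<open>Cones with a weakly compact base\<close>

text \<open>For convex nonempty arguments this is the convex hull of their union. It is written as the image of
  a product, so that compactness passes to it.\<close>

definition segments_between :: "'a::real_vector set \<Rightarrow> 'a set \<Rightarrow> 'a set" where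
  "segments_between A B = (\<lambda>(t, a, b). (1 - t) *\<^sub>R a + t *\<^sub>R b) ` ({0..1} \<times> A \<times> B)"

lemma segments_betweenI:
  "a \<in> A \<Longrightarrow> b \<in> B \<Longrightarrow> 0 \<le> u \<Longrightarrow> 0 \<le> v \<Longrightarrow> u + v = 1 \<Longrightarrow> u *\<^sub>R a + v *\<^sub>R b \<in> segments_between A B"
  unfolding segments_between_def by (intro image_eqI[of _ _ "(v, a, b)"]) (auto simp flip: eq_diff_eq)

lemma segments_betweenE:
  assumes "z \<in> segments_between A B"
  obtains a b u v where "a \<in> A" "b \<in> B" "0 \<le> u" "0 \<le> v" "u + v = 1" "z = u *\<^sub>R a + v *\<^sub>R b"
proof -
  obtain t a b where t: "0 \<le> t" "t \<le> 1" "a \<in> A" "b \<in> B" "z = (1 - t) *\<^sub>R a + t *\<^sub>R b"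
    using assms by (auto simp: segments_between_def)
  then show ?thesis using that[of a b "1 - t" t] by simp
qed

text \<open>Two points of a convex set with nonnegative weights merge into one point carrying the total weight, also
  when that weight is zero.\<close>

lemma convex_combine:
  assumes A: "convex A" and a: "a \<in> A" "a' \<in> A" and uv: "0 \<le> u" "0 \<le> v"
  obtains a'' where "a'' \<in> A" "u *\<^sub>R a + v *\<^sub>R a' = (u + v) *\<^sub>R a''"
proof (cases "u + v = 0")
  case True
  then have "u = 0" "v = 0" using uv by auto
  then show ?thesis using that[OF a(1)] by simp
next
  case False
  then have "0 < u + v" using uv by linarith
  then have "(u / (u + v)) *\<^sub>R a + (v / (u + v)) *\<^sub>R a' \<in> A"
    using a uv by (intro convexD[OF A]) (auto simp: add_divide_distrib[symmetric])
  from that[OF this] show ?thesis using False by (simp add: scaleR_add_right)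
qed

lemma convex_segments_between:
  assumes A: "convex A" and B: "convex B"
  shows "convex (segments_between A B)"
proof (rule convexI)
  fix x y and s r :: real
  assume x: "x \<in> segments_between A B" and y: "y \<in> segments_between A B" and sr: "0 \<le> s" "0 \<le> r" "s + r = 1"
  obtain a b u v where *: "a \<in> A" "b \<in> B" "0 \<le> u" "0 \<le> v" "u + v = 1" "x = u *\<^sub>R a + v *\<^sub>R b"
    using x by (rule segments_betweenE)
  obtain a' b' u' v' where **: "a' \<in> A" "b' \<in> B" "0 \<le> u'" "0 \<le> v'" "u' + v' = 1" "y = u' *\<^sub>R a' + v' *\<^sub>R b'"
    using y by (rule segments_betweenE)
  obtain a'' where a'': "a'' \<in> A" "(s * u) *\<^sub>R a + (r * u') *\<^sub>R a' = (s * u + r * u') *\<^sub>R a''"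
    using convex_combine[OF A *(1) **(1), of "s * u" "r * u'"] * ** sr by auto
  obtain b'' where b'': "b'' \<in> B" "(s * v) *\<^sub>R b + (r * v') *\<^sub>R b' = (s * v + r * v') *\<^sub>R b''"
    using convex_combine[OF B *(2) **(2), of "s * v" "r * v'"] * ** sr by auto
  have "(s * u + r * u') + (s * v + r * v') = s * (u + v) + r * (u' + v')"
    by (simp add: algebra_simps)
  then have "(s * u + r * u') + (s * v + r * v') = 1" using * ** sr by simp
  then have "(s * u + r * u') *\<^sub>R a'' + (s * v + r * v') *\<^sub>R b'' \<in> segments_between A B"
    using a''(1) b''(1) * ** sr by (intro segments_betweenI) auto
  also have "(s * u + r * u') *\<^sub>R a'' + (s * v + r * v') *\<^sub>R b'' = s *\<^sub>R x + r *\<^sub>R y"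
    unfolding a''(2)[symmetric] b''(2)[symmetric] *(6) **(6) by (simp add: scaleR_add_right)
  finally show "s *\<^sub>R x + r *\<^sub>R y \<in> segments_between A B" .
qed

lemma weakly_compact_segments_between:
  fixes A B :: "'a::topological_vector_space set"
  assumes "compactin weak_topology A" "compactin weak_topology B"
  shows "compactin weak_topology (segments_between A B)"
  unfolding segments_between_def
proof -
  let ?X = "prod_topology euclideanreal (prod_topology weak_topology weak_topology)"
  let ?j = "\<lambda>(t, a, b). (1 - t) *\<^sub>R a + t *\<^sub>R (b::'a)"
  have "continuous_map ?X weak_topology ?j"
  proof (rule continuous_map_into_weak)
    fix f :: "'a \<Rightarrow> real" assume f: "f \<in> topological_dual"
    have t: "continuous_map ?X euclideanreal fst"
      by (rule continuous_map_fst)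
    have a: "continuous_map ?X euclideanreal (\<lambda>z. f (fst (snd z)))"
      and b: "continuous_map ?X euclideanreal (\<lambda>z. f (snd (snd z)))"
      using continuous_map_compose[OF continuous_map_compose[OF continuous_map_snd continuous_map_fst] continuous_map_weak_dual[OF f]]
        continuous_map_compose[OF continuous_map_compose[OF continuous_map_snd continuous_map_snd] continuous_map_weak_dual[OF f]]
      by (simp_all add: o_def)
    have "continuous_map ?X euclideanreal (\<lambda>z. (1 - fst z) * f (fst (snd z)) + fst z * f (snd (snd z)))"
      by (intro continuous_map_add continuous_map_real_mult continuous_map_diff t a b) simp
    then show "continuous_map ?X euclideanreal (\<lambda>z. f (?j z))"
      by (simp add: case_prod_beta topological_dualD[OF f])
  qed
  moreover have "compactin ?X ({0..1} \<times> A \<times> B)"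
    using assms by (simp add: compactin_Times)
  ultimately show "compactin weak_topology (?j ` ({0..1} \<times> A \<times> B))"
    by (rule image_compactin[rotated])
qed

text \<open>The closed convex hull of a weakly compact set may reach outside a convex set \<open>Z\<close> that is not closed. For a finite union of
  compact convex pieces the hull itself is compact, so this cannot happen.\<close>

lemma weakly_compact_convex_cover:
  fixes Z :: "'a::topological_vector_space set"
  assumes "finite \<A>" "convex Z"
    and "\<And>A. A \<in> \<A> \<Longrightarrow> compactin weak_topology A \<and> convex A \<and> A \<subseteq> Z"
  obtains H where "compactin weak_topology H" "convex H" "\<Union>\<A> \<subseteq> H" "H \<subseteq> Z"
proof -
  have "\<exists>H. compactin weak_topology H \<and> convex H \<and> \<Union>\<A> \<subseteq> H \<and> H \<subseteq> Z"
    using assms(1,3)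
  proof induction
    case empty
    then show ?case by (intro exI[of _ "{}"]) simp
  next
    case (insert A \<A>)
    then obtain H where H: "compactin weak_topology H" "convex H" "\<Union>\<A> \<subseteq> H" "H \<subseteq> Z"
      by auto
    have A: "compactin weak_topology A" "convex A" "A \<subseteq> Z" using insert.prems by auto
    show ?case
    proof (cases "H = {}")
      case True
      then show ?thesis using A H by (intro exI[of _ A]) auto
    next
      case False
      show ?thesis
      proof (cases "A = {}")
        case True
        then show ?thesis using H by (intro exI[of _ H]) auto
      next
        case A': False
        let ?S = "segments_between A H"
        have "compactin weak_topology ?S" "convex ?S"
          using A H by (auto intro: weakly_compact_segments_between convex_segments_between)
        moreover have "A \<subseteq> ?S"
          using False segments_betweenI[of _ A _ H 1 0] by fastforce
        moreover have "H \<subseteq> ?S"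
          using A' segments_betweenI[of _ A _ H 0 1] by fastforce
        moreover have "?S \<subseteq> Z"
          using A(3) H(4) assms(2) by (auto elim!: segments_betweenE intro: convexD)
        ultimately show ?thesis using H(3) by (intro exI[of _ ?S]) auto
      qed
    qed
  qed
  then show ?thesis using that by blast
qed

lemma convex_proper_cone_minus_zero:
  assumes C: "convex_cone C" "proper_cone C"
  shows "convex (C - {0})"
  unfolding convex_def
proof clarify
  fix x y and u v :: real
  assume x: "x \<in> C" "x \<noteq> 0" and y: "y \<in> C" "y \<noteq> 0" and uv: "0 \<le> u" "0 \<le> v" "u + v = 1"
  have ux: "u *\<^sub>R x \<in> C" and vy: "v *\<^sub>R y \<in> C"
    using x y uv by (auto intro: convex_cone_scaleR[OF C(1)])
  have "u *\<^sub>R x + v *\<^sub>R y \<noteq> 0"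
  proof
    assume "u *\<^sub>R x + v *\<^sub>R y = 0"
    then have eq: "u *\<^sub>R x = - (v *\<^sub>R y)" by (simp add: eq_neg_iff_add_eq_0)
    then have "u *\<^sub>R x \<in> C \<inter> uminus ` C" using ux vy by blast
    then have "u *\<^sub>R x \<in> {0}" using C(2) by (simp only: proper_cone_def)
    then have "u = 0" using x(2) by simp
    then show False using eq y(2) uv(3) by simp
  qed
  then show "u *\<^sub>R x + v *\<^sub>R y \<in> C - {0}"
    using convex_cone_add[OF C(1) ux vy] by simp
qed

text \<open>A basic weak neighbourhood of zero gives finitely many functionals \<open>F'\<close>, closed under negation, such that
  \<open>D = {c \<in> C. \<forall>f\<in>F'. f c \<le> 1/2}\<close> is weakly compact. No ray of \<open>C\<close> fits into \<open>D\<close>, so every ray leaves it through one of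
  the finitely many convex faces \<open>P f = {c \<in> D. 1/2 \<le> f c}\<close>. The faces lie in \<open>C - {0}\<close>, which is convex because \<open>C\<close> is proper;
  hence a weakly compact convex set \<open>H \<subseteq> C - {0}\<close> contains them all. A functional \<open>\<phi>\<close> that separates \<open>H\<close>
  from zero is bounded below on the faces by some \<open>\<delta> > 0\<close>, and therefore dominates a multiple of the gauge of \<open>D\<close> on \<open>C\<close>.\<close>

theorem weakly_locally_compact_cone_compact_base:
  fixes C :: "'a::{locally_convex_space, t2_space} set"
  assumes C: "convex_cone C" "proper_cone C" "weakly_locally_compact C"
  obtains \<phi> where "\<phi> \<in> topological_dual" "\<And>c. c \<in> C \<Longrightarrow> c \<noteq> 0 \<Longrightarrow> 0 < \<phi> c"
    "\<And>r. compactin weak_topology {c \<in> C. \<phi> c \<le> r}"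
proof -
  have C0: "0 \<in> C" using C(2) by (auto simp: proper_cone_def)
  obtain U K where UK: "openin (subtopology weak_topology C) U" "compactin (subtopology weak_topology C) K"
    "0 \<in> U" "U \<subseteq> K"
    using C(3) C0 unfolding weakly_locally_compact_def locally_compact_space_def by auto
  obtain W where W: "openin weak_topology W" "U = W \<inter> C"
    using UK(1) unfolding openin_subtopology by blast
  have K: "compactin weak_topology K" "K \<subseteq> C"
    using UK(2) by (auto simp: compactin_subtopology)
  obtain F where F: "finite F" "F \<subseteq> topological_dual" "{z. \<forall>f\<in>F. \<bar>f z - f 0\<bar> < 1} \<subseteq> W"
    using weak_topology_basis[OF W(1), of 0] UK(3) W(2) by blast
  define F' where "F' = F \<union> (\<lambda>f x. - f x) ` F"
  have F': "finite F'" "F' \<subseteq> topological_dual"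
    using F topological_dual_uminus by (auto simp: F'_def)
  define D where "D = {c \<in> C. \<forall>f\<in>F'. f c \<le> 1 / 2}"
  have "D \<subseteq> W"
  proof
    fix z assume z: "z \<in> D"
    have "\<bar>f z - f 0\<bar> < 1" if "f \<in> F" for f
    proof -
      have "f \<in> F'" "(\<lambda>x. - f x) \<in> F'" using that by (auto simp: F'_def)
      moreover have "\<forall>f\<in>F'. f z \<le> 1 / 2" using z by (simp add: D_def)
      ultimately have "f z \<le> 1 / 2" "- f z \<le> 1 / 2" by fastforce+
      moreover have "f 0 = 0" using that F(2) topological_dualD(6) by blast
      ultimately show ?thesis by simp
    qed
    then show "z \<in> W" using F(3) by blast
  qed
  then have "D \<subseteq> K" using UK(4) W(2) by (auto simp: D_def)
  then have "D = {x. \<forall>f\<in>F'. f x \<le> 1 / 2} \<inter> K" using K(2) by (auto simp: D_def)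
  then have D: "compactin weak_topology D"
    using closedin_weak_halfspaces[of F' "\<lambda>f. f" "\<lambda>_. 1 / 2"] F'(2) K(1)
    by (simp add: closed_Int_compactin subset_iff)
  have "D = C \<inter> {x. \<forall>f\<in>F'. f x \<le> 1 / 2}" by (auto simp: D_def)
  moreover have "convex {x. \<forall>f\<in>F'. f x \<le> 1 / 2}"
    using F'(2) topological_dualD(1) by (intro convex_halfspaces) blast
  ultimately have convD: "convex D"
    using C(1) by (simp add: convex_cone_def convex_Int)
  have pos: "\<exists>f\<in>F'. 0 < f c" if c: "c \<in> C" "c \<noteq> 0" for c
  proof (rule ccontr)
    assume neg: "\<not> (\<exists>f\<in>F'. 0 < f c)"
    have sD: "s *\<^sub>R c \<in> D" if "0 \<le> s" for s
    proof -
      have "f (s *\<^sub>R c) \<le> 1 / 2" if f: "f \<in> F'" for f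
      proof -
        have "s * f c \<le> 0" using neg f \<open>0 \<le> s\<close> by (intro mult_nonneg_nonpos) auto
        moreover have "f (s *\<^sub>R c) = s * f c" using F'(2) f by (auto intro: topological_dualD(5))
        ultimately show ?thesis by simp
      qed
      then show ?thesis using c(1) that by (auto simp: D_def intro: convex_cone_scaleR[OF C(1)])
    qed
    obtain g where g: "g \<in> topological_dual" "g 0 < g c"
      using dual_separates_points[OF c(2)] by blast
    then have gc: "0 < g c" by (simp add: topological_dualD)
    obtain M where M: "\<And>x. x \<in> D \<Longrightarrow> \<bar>g x\<bar> \<le> M"
      using weakly_compact_dual_bounded[OF D g(1)] by blast
    have "0 \<le> M" using M[OF sD[of 0]] by simp
    then have "g (((M + 1) / g c) *\<^sub>R c) \<le> M" using M[OF sD[of "(M + 1) / g c"]] gc by simp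
    then show False using gc by (simp add: topological_dualD[OF g(1)])
  qed
  define P where "P f = {c \<in> D. 1 / 2 \<le> f c}" for f :: "'a \<Rightarrow> real"
  have P: "compactin weak_topology (P f) \<and> convex (P f) \<and> P f \<subseteq> C - {0}" if "f \<in> F'" for f
  proof -
    have f: "f \<in> topological_dual" using that F'(2) by blast
    have eq: "P f = {x. \<forall>i\<in>{()}. - f x \<le> - (1 / 2)} \<inter> D" by (auto simp: P_def)
    have "compactin weak_topology (P f)"
      unfolding eq using topological_dual_uminus[OF f] D
      by (intro closed_Int_compactin closedin_weak_halfspaces)
    moreover have "convex (P f)"
      unfolding eq using topological_dualD(1)[OF topological_dual_uminus[OF f]] convD
      by (intro convex_Int convex_halfspaces)
    moreover have "P f \<subseteq> C - {0}"
      using topological_dualD(6)[OF f] by (auto simp: P_def D_def)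
    ultimately show ?thesis by blast
  qed
  obtain H where H: "compactin weak_topology H" "convex H" "\<Union>(P ` F') \<subseteq> H" "H \<subseteq> C - {0}"
    using weakly_compact_convex_cover[of "P ` F'" "C - {0}"] F'(1) P
      convex_proper_cone_minus_zero[OF C(1,2)] by blast
  have "closed H"
    using compactin_imp_closedin[OF Hausdorff_space_weak H(1)] by (rule closedin_weak_imp_closed)
  then obtain f \<delta> where f: "f \<in> topological_dual" "0 < \<delta>" "\<And>h. h \<in> H \<Longrightarrow> f h + \<delta> \<le> f 0"
    using separate_point_closed_convex[OF H(2), of 0] H(4) by blast
  define \<phi> where "\<phi> x = - f x" for x
  have \<phi>: "\<phi> \<in> topological_dual"
    unfolding \<phi>_def using f(1) by (rule topological_dual_uminus)
  have \<phi>H: "\<delta> \<le> \<phi> h" if "h \<in> H" for h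
    using f(3)[OF that] topological_dualD(6)[OF f(1)] by (simp add: \<phi>_def)
  \<comment> \<open>Here \<open>\<mu>\<close> is the maximum of the functionals in \<open>F'\<close>, so that \<open>c / (2 \<mu>)\<close> lies on a face.\<close>
  have bound: "\<exists>\<mu>>0. 2 * \<mu> * \<delta> \<le> \<phi> c \<and> (\<forall>f\<in>F'. f c \<le> \<mu>)" if c: "c \<in> C" "c \<noteq> 0" for c
  proof -
    define \<mu> where "\<mu> = Max ((\<lambda>f. f c) ` F')"
    have "F' \<noteq> {}" using pos[OF c] by blast
    then have "\<mu> \<in> (\<lambda>f. f c) ` F'"
      unfolding \<mu>_def using F'(1) by (intro Max_in) auto
    then obtain h where h: "h \<in> F'" "h c = \<mu>" by (metis imageE)
    have le: "f c \<le> \<mu>" if "f \<in> F'" for f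
      unfolding \<mu>_def using F'(1) that by (intro Max_ge) auto
    then have "0 < \<mu>" using pos[OF c] by force
    let ?c = "(1 / (2 * \<mu>)) *\<^sub>R c"
    have val: "f ?c = f c / (2 * \<mu>)" if "f \<in> topological_dual" for f
      using topological_dualD(5)[OF that] by simp
    have "f ?c \<le> 1 / 2" if "f \<in> F'" for f
    proof -
      have "f ?c = f c / (2 * \<mu>)" using F'(2) that by (intro val) blast
      also have "\<dots> \<le> \<mu> / (2 * \<mu>)" using le[OF that] \<open>0 < \<mu>\<close> by (intro divide_right_mono) auto
      finally show ?thesis using \<open>0 < \<mu>\<close> by simp
    qed
    then have "?c \<in> D"
      using c(1) \<open>0 < \<mu>\<close> by (simp add: D_def convex_cone_scaleR[OF C(1)])
    moreover have "h ?c = 1 / 2" using val[of h] h F'(2) \<open>0 < \<mu>\<close> by auto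
    ultimately have "?c \<in> P h" by (simp add: P_def)
    then have "\<delta> \<le> \<phi> ?c" using \<phi>H H(3) h(1) by blast
    then have "\<delta> \<le> \<phi> c / (2 * \<mu>)" unfolding val[OF \<phi>] .
    then have "2 * \<mu> * \<delta> \<le> \<phi> c"
      using \<open>0 < \<mu>\<close> by (simp add: pos_le_divide_eq mult.commute)
    then show ?thesis using \<open>0 < \<mu>\<close> le by blast
  qed
  have "compactin weak_topology {c \<in> C. \<phi> c \<le> r}" for r
  proof -
    \<comment> \<open>Every point of the section has \<open>2 \<mu> \<le> r / \<delta>\<close>, so the section lies in \<open>k D\<close>; adding 1 keeps \<open>k\<close> positive.\<close>
    define k where "k = \<bar>r\<bar> / \<delta> + 1"
    have k: "0 < k" using f(2) by (simp add: k_def add_nonneg_pos)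
    have "c \<in> (\<lambda>x. k *\<^sub>R x) ` D" if c: "c \<in> C" "\<phi> c \<le> r" for c
    proof (rule image_eqI)
      show "c = k *\<^sub>R ((1 / k) *\<^sub>R c)" using k by simp
      have "f c \<le> k / 2" if fF: "f \<in> F'" for f
      proof (cases "c = 0")
        case True
        have "f 0 = 0" using F'(2) fF topological_dualD(6) by blast
        then show ?thesis using True k by simp
      next
        case False
        then obtain \<mu> where \<mu>: "0 < \<mu>" "2 * \<mu> * \<delta> \<le> \<phi> c" "f c \<le> \<mu>"
          using bound[OF c(1) False] fF by blast
        then have "2 * \<mu> * \<delta> \<le> \<bar>r\<bar>" using c(2) by linarith
        then have "2 * \<mu> \<le> \<bar>r\<bar> / \<delta>" using f(2) by (simp add: pos_le_divide_eq)
        then show ?thesis using \<mu>(3) by (simp add: k_def)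
      qed
      have "f ((1 / k) *\<^sub>R c) \<le> 1 / 2" if "f \<in> F'" for f
      proof -
        have eq: "f ((1 / k) *\<^sub>R c) = f c / k"
          using topological_dualD(5)[OF subsetD[OF F'(2) that], of "1 / k" c] by simp
        show ?thesis
          unfolding eq using \<open>\<And>f. f \<in> F' \<Longrightarrow> f c \<le> k / 2\<close>[OF that] k by (simp add: field_simps)
      qed
      then show "(1 / k) *\<^sub>R c \<in> D"
        using c(1) k by (simp add: D_def convex_cone_scaleR[OF C(1)])
    qed
    moreover have "(\<lambda>x. k *\<^sub>R x) ` D \<subseteq> C"
      using k by (auto simp: D_def intro: convex_cone_scaleR[OF C(1)])
    ultimately have "{c \<in> C. \<phi> c \<le> r} = {c. \<phi> c \<le> r} \<inter> (\<lambda>x. k *\<^sub>R x) ` D" by auto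
    moreover have "continuous_map weak_topology weak_topology (\<lambda>x::'a. k *\<^sub>R x)"
      by (intro continuous_map_weak_linear continuous_on_scaleR_tvs) simp
    ultimately show ?thesis
      using image_compactin[OF D] closed_Int_compactin closedin_weak_sublevel[OF \<phi>] by metis
  qed
  moreover have "0 < \<phi> c" if "c \<in> C" "c \<noteq> 0" for c
  proof -
    obtain \<mu> where "0 < \<mu>" "2 * \<mu> * \<delta> \<le> \<phi> c" using bound[OF \<open>c \<in> C\<close> \<open>c \<noteq> 0\<close>] by blast
    moreover have "0 < 2 * \<mu> * \<delta>" using calculation(1) f(2) by simp
    ultimately show ?thesis by linarith
  qed
  ultimately show ?thesis using that \<phi> by blast
qed

section \<open>Small slices of countable sets\<close>

text \<open>Arbitrary rational coefficients keep this countable set closed under addition and rational scaling, which is more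
  convenient than a dense subset of the convex hull.\<close>

definition rational_combinations :: "'a::real_vector set \<Rightarrow> 'a set" where
  "rational_combinations Y = (\<lambda>w. \<Sum>(r, y)\<leftarrow>w. r *\<^sub>R y) ` lists (\<rat> \<times> Y)"

lemma countable_rational_combinations: "countable Y \<Longrightarrow> countable (rational_combinations Y)"
  unfolding rational_combinations_def using countable_rat by blast

lemma rational_combinations_closed:
  shows "y \<in> Y \<Longrightarrow> y \<in> rational_combinations Y"
    and "x \<in> rational_combinations Y \<Longrightarrow> y \<in> rational_combinations Y \<Longrightarrow> x + y \<in> rational_combinations Y"
    and "r \<in> \<rat> \<Longrightarrow> x \<in> rational_combinations Y \<Longrightarrow> r *\<^sub>R x \<in> rational_combinations Y"
proof -
  show "y \<in> Y \<Longrightarrow> y \<in> rational_combinations Y"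
    unfolding rational_combinations_def by (rule image_eqI[of _ _ "[(1, y)]"]) auto
  show "x + y \<in> rational_combinations Y" if xy: "x \<in> rational_combinations Y" "y \<in> rational_combinations Y"
  proof -
    obtain w v where "w \<in> lists (\<rat> \<times> Y)" "v \<in> lists (\<rat> \<times> Y)"
      "x = (\<Sum>(r, y)\<leftarrow>w. r *\<^sub>R y)" "y = (\<Sum>(r, y)\<leftarrow>v. r *\<^sub>R y)"
      using xy unfolding rational_combinations_def by blast
    then show ?thesis
      unfolding rational_combinations_def by (intro image_eqI[of _ _ "w @ v"]) auto
  qed
  show "r *\<^sub>R x \<in> rational_combinations Y" if r: "r \<in> \<rat>" and x: "x \<in> rational_combinations Y"
  proof -
    obtain w where w: "w \<in> lists (\<rat> \<times> Y)" "x = (\<Sum>(r, y)\<leftarrow>w. r *\<^sub>R y)"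
      using x unfolding rational_combinations_def by blast
    have "r *\<^sub>R (\<Sum>(r, y)\<leftarrow>w. r *\<^sub>R y) = (\<Sum>(r, y)\<leftarrow>map (\<lambda>(s, y). (r * s, y)) w. r *\<^sub>R y)"
      by (induction w) (auto simp: scaleR_add_right)
    moreover have "map (\<lambda>(s, y). (r * s, y)) w \<in> lists (\<rat> \<times> Y)"
      using w(1) r by (induction w) auto
    ultimately show ?thesis
      unfolding rational_combinations_def w(2) by (rule image_eqI)
  qed
qed

text \<open>The hypothesis on \<open>x\<close> says that no closed half-space separates \<open>x\<close> from \<open>Y\<close>, that is, that \<open>x\<close> belongs to the closed convex
  hull of \<open>Y\<close>. The points that \<open>p\<close> cannot distinguish from limits of rational combinations form a closed subspace
  containing \<open>Y\<close>, so a point outside would be separated from \<open>Y\<close>.\<close>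

lemma rational_combinations_dense:
  fixes p :: "'a::locally_convex_space \<Rightarrow> real"
  assumes p: "continuous_seminorm p" and Y: "Y \<noteq> {}"
    and x: "\<And>f \<beta>. f \<in> topological_dual \<Longrightarrow> (\<And>y. y \<in> Y \<Longrightarrow> f y \<le> \<beta>) \<Longrightarrow> f x \<le> \<beta>"
    and "0 < e"
  obtains d where "d \<in> rational_combinations Y" "p (x - d) < e"
proof -
  let ?D = "rational_combinations Y"
  define A where "A = {x. \<forall>e>0. \<exists>d\<in>?D. p (x - d) < e}"
  have memA: "\<exists>d\<in>?D. p (u - d) < e" if "u \<in> A" "0 < e" for u e
    using that by (simp add: A_def)
  have add: "u + v \<in> A" if "u \<in> A" "v \<in> A" for u v
    unfolding A_def
  proof clarify
    fix e :: real assume "0 < e"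
    then obtain d d' where d: "d \<in> ?D" "p (u - d) < e / 2" "d' \<in> ?D" "p (v - d') < e / 2"
      using memA[OF \<open>u \<in> A\<close>, of "e / 2"] memA[OF \<open>v \<in> A\<close>, of "e / 2"] by auto
    have "p (u + v - (d + d')) \<le> p (u - d) + p (v - d')"
      using continuous_seminormD(4)[OF p, of "u - d" "v - d'"] by (simp only: add_diff_add)
    then have "p (u + v - (d + d')) < e" using d by simp
    then show "\<exists>d\<in>?D. p (u + v - d) < e"
      using d rational_combinations_closed(2) by blast
  qed
  have scale: "c *\<^sub>R u \<in> A" if "u \<in> A" for c u
    unfolding A_def
  proof clarify
    fix e :: real assume "0 < e"
    then obtain d where d: "d \<in> ?D" "p (u - d) < e / (2 * (\<bar>c\<bar> + 1))"
      using memA[OF \<open>u \<in> A\<close>, of "e / (2 * (\<bar>c\<bar> + 1))"] by auto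
    have pd: "0 \<le> p d" by (rule continuous_seminormD(7)[OF p])
    then have "c < c + e / (2 * (p d + 1))" using \<open>0 < e\<close> by simp
    then obtain r where r: "r \<in> \<rat>" "c < r" "r < c + e / (2 * (p d + 1))"
      using Rats_dense_in_real by blast
    have "p (c *\<^sub>R u - r *\<^sub>R d) = p (c *\<^sub>R (u - d) + (c - r) *\<^sub>R d)"
      by (simp add: algebra_simps)
    also have "\<dots> \<le> \<bar>c\<bar> * p (u - d) + \<bar>c - r\<bar> * p d"
      using continuous_seminormD(4)[OF p, of "c *\<^sub>R (u - d)" "(c - r) *\<^sub>R d"]
      by (simp add: continuous_seminorm_scaleR[OF p])
    also have "\<dots> < e / 2 + e / 2"
    proof (rule add_less_le_mono)
      have "\<bar>c\<bar> * p (u - d) \<le> (\<bar>c\<bar> + 1) * p (u - d)"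
        using continuous_seminormD(7)[OF p, of "u - d"] by (simp add: mult_right_mono)
      also have "\<dots> < (\<bar>c\<bar> + 1) * (e / (2 * (\<bar>c\<bar> + 1)))"
        using d(2) by (intro mult_strict_left_mono) auto
      also have "\<dots> = e / 2" by (simp add: field_simps)
      finally show "\<bar>c\<bar> * p (u - d) < e / 2" .
      have "\<bar>c - r\<bar> * p d \<le> (e / (2 * (p d + 1))) * (p d + 1)"
        using r pd \<open>0 < e\<close> by (intro mult_mono) auto
      also have "\<dots> = e / 2" using pd by (simp add: field_simps)
      finally show "\<bar>c - r\<bar> * p d \<le> e / 2" .
    qed
    finally show "\<exists>d\<in>?D. p (c *\<^sub>R u - d) < e"
      using rational_combinations_closed(3)[OF r(1) d(1)] by auto
  qed
  have "convex A"
    using add scale by (auto intro: convexI)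
  have "closed A"
    unfolding closed_def
  proof (subst open_subopen, clarify)
    fix z assume "z \<notin> A"
    then obtain e where e: "0 < e" "\<And>d. d \<in> ?D \<Longrightarrow> e \<le> p (z - d)"
      unfolding A_def by (auto simp: not_less)
    let ?T = "{w. p (w - z) < e / 2}"
    have "open ?T"
      using continuous_on_seminorm_dist[OF p] by (intro open_Collect_less) auto
    moreover have "z \<in> ?T" using e(1) continuous_seminormD(6)[OF p] by simp
    moreover have "?T \<subseteq> - A"
    proof clarify
      fix w assume w: "p (w - z) < e / 2" "w \<in> A"
      then obtain d where d: "d \<in> ?D" "p (w - d) < e / 2"
        using memA[of w "e / 2"] w(2) e(1) by auto
      have "p (z - d) \<le> p (w - z) + p (w - d)"
        using continuous_seminormD(4)[OF p, of "z - w" "w - d"] continuous_seminormD(8)[OF p, of z w] by simp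
      then show False using e(2)[OF d(1)] d(2) w(1) by simp
    qed
    ultimately show "\<exists>T. open T \<and> z \<in> T \<and> T \<subseteq> - A" by blast
  qed
  have YA: "y \<in> A" if "y \<in> Y" for y
    unfolding A_def
  proof clarify
    fix e :: real assume "0 < e"
    then have "p (y - y) < e" using continuous_seminormD(6)[OF p] by simp
    then show "\<exists>d\<in>?D. p (y - d) < e"
      using rational_combinations_closed(1)[OF that] by blast
  qed
  have "x \<in> A"
  proof (rule ccontr)
    assume "x \<notin> A"
    then obtain f \<delta> where f: "f \<in> topological_dual" "0 < \<delta>" "\<And>a. a \<in> A \<Longrightarrow> f a + \<delta> \<le> f x"
      using separate_point_closed_convex[OF \<open>convex A\<close> \<open>closed A\<close>] by blast
    have "f x \<le> f x - \<delta>"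
    proof (rule x[OF f(1)])
      fix y assume "y \<in> Y"
      then show "f y \<le> f x - \<delta>" using f(3)[OF YA] by (simp add: le_diff_eq)
    qed
    then show False using f(2) by simp
  qed
  then show ?thesis using memA[OF _ \<open>0 < e\<close>] that by blast
qed

text \<open>For \<open>L\<close> inside the closed convex hull of \<open>Y\<close> this says that each functional attains on \<open>L\<close> its supremum over \<open>Y\<close>.\<close>

definition norming :: "'a::topological_vector_space set \<Rightarrow> 'a set \<Rightarrow> bool" where
  "norming Y L \<longleftrightarrow> (\<forall>f\<in>topological_dual. \<exists>l\<in>L. \<forall>y\<in>Y. f y \<le> f l)"

text \<open>For a chain of norming sets and a fixed functional, the points with maximal value in the members form a chain of nonempty
  compact sets, so the intersection of the chain is again norming and Zorn's lemma applies.\<close>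

lemma minimal_norming_set_exists:
  fixes Q :: "'a::{locally_convex_space, t2_space} set"
  assumes Q: "compactin weak_topology Q" and Y: "Y \<subseteq> Q" "Y \<noteq> {}"
  obtains L where "closedin weak_topology L" "L \<subseteq> Q" "norming Y L"
    "\<And>L'. closedin weak_topology L' \<Longrightarrow> L' \<subset> L \<Longrightarrow> \<not> norming Y L'"
proof -
  define S where "S = {L. closedin weak_topology L \<and> L \<subseteq> Q \<and> norming Y L}"
  have "norming Y Q"
    unfolding norming_def
  proof
    fix f :: "'a \<Rightarrow> real" assume "f \<in> topological_dual"
    then obtain k where "k \<in> Q" "\<And>x. x \<in> Q \<Longrightarrow> f x \<le> f k"
      using weakly_compact_dual_attains_sup[OF Q] Y by blast
    then show "\<exists>l\<in>Q. \<forall>y\<in>Y. f y \<le> f l" using Y(1) by blast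
  qed
  then have QS: "Q \<in> S"
    using compactin_imp_closedin[OF Hausdorff_space_weak Q] by (simp add: S_def)
  have "\<exists>m\<in>S. \<forall>a\<in>S. m \<supseteq> a \<longrightarrow> a = m"
  proof (rule predicate_Zorn)
    show "partial_order_on S (relation_of (\<lambda>x y. x \<supseteq> y) S)"
      by (intro partial_order_on_relation_ofI) auto
  next
    fix c assume "c \<in> Chains (relation_of (\<lambda>x y. x \<supseteq> y) S)"
    then have cS: "c \<subseteq> S" and chain: "\<And>U V. U \<in> c \<Longrightarrow> V \<in> c \<Longrightarrow> U \<subseteq> V \<or> V \<subseteq> U"
      by (auto simp: Chains_def relation_of_def)
    show "\<exists>u\<in>S. \<forall>a\<in>c. a \<supseteq> u"
    proof (cases "c = {}")
      case True
      then show ?thesis using QS by blast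
    next
      case False
      have "norming Y (\<Inter>c)"
        unfolding norming_def
      proof
        fix f :: "'a \<Rightarrow> real" assume f: "f \<in> topological_dual"
        let ?H = "{x. \<forall>y\<in>Y. - f x \<le> - f y}"
        have H: "closedin weak_topology ?H"
          using topological_dual_uminus[OF f] by (intro closedin_weak_halfspaces)
        have "\<Inter>((\<lambda>L. L \<inter> ?H) ` c) \<noteq> {}"
        proof (rule compactin_chain_Inter[OF Q])
          show "(\<lambda>L. L \<inter> ?H) ` c \<noteq> {}" using False by simp
          show "U \<subseteq> V \<or> V \<subseteq> U" if "U \<in> (\<lambda>L. L \<inter> ?H) ` c" "V \<in> (\<lambda>L. L \<inter> ?H) ` c" for U V
            using that chain by blast
          show "closedin weak_topology U \<and> U \<subseteq> Q \<and> U \<noteq> {}" if U: "U \<in> (\<lambda>L. L \<inter> ?H) ` c" for U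
          proof -
            obtain L where L: "L \<in> c" "U = L \<inter> ?H" using U by blast
            then have "L \<in> S" using cS by blast
            then show ?thesis
              using L(2) H f by (auto simp: S_def norming_def intro: closedin_Int)
          qed
        qed
        then show "\<exists>l\<in>\<Inter>c. \<forall>y\<in>Y. f y \<le> f l" using False by auto
      qed
      moreover have "closedin weak_topology (\<Inter>c)"
        using False cS by (intro closedin_Inter) (auto simp: S_def)
      moreover have "\<Inter>c \<subseteq> Q" using False cS by (auto simp: S_def)
      ultimately show ?thesis by (intro bexI[of _ "\<Inter>c"]) (auto simp: S_def)
    qed
  qed
  then obtain L where L: "L \<in> S" "\<And>a. a \<in> S \<Longrightarrow> a \<subseteq> L \<Longrightarrow> a = L" by blast
  show ?thesis
  proof
    show "closedin weak_topology L" "L \<subseteq> Q" "norming Y L" using L(1) by (auto simp: S_def)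
    show "\<not> norming Y L'" if "closedin weak_topology L'" "L' \<subset> L" for L'
      using that L by (auto simp: S_def)
  qed
qed

text \<open>The sublevel set \<open>{x. \<Phi> x \<le> \<beta>}\<close> is closed and convex; a functional separating \<open>y\<close> from it would be larger at \<open>y\<close>
  than anywhere on \<open>L\<close>.\<close>

lemma norming_maximum_principle:
  fixes \<Phi> :: "'a::locally_convex_space \<Rightarrow> real"
  assumes "norming Y L" and cont: "continuous_on UNIV \<Phi>"
    and cvx: "\<And>x y u v. 0 \<le> u \<Longrightarrow> 0 \<le> v \<Longrightarrow> u + v = 1 \<Longrightarrow> \<Phi> (u *\<^sub>R x + v *\<^sub>R y) \<le> u * \<Phi> x + v * \<Phi> y"
    and L: "\<And>l. l \<in> L \<Longrightarrow> \<Phi> l \<le> \<beta>" and "y \<in> Y"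
  shows "\<Phi> y \<le> \<beta>"
proof (rule ccontr)
  assume "\<not> \<Phi> y \<le> \<beta>"
  then have "y \<notin> {x. \<Phi> x \<le> \<beta>}" by simp
  then obtain f \<delta> where f: "f \<in> topological_dual" "0 < \<delta>" "\<And>a. a \<in> {x. \<Phi> x \<le> \<beta>} \<Longrightarrow> f a + \<delta> \<le> f y"
    using separate_point_closed_convex[OF closed_convex_sublevel[OF cont cvx]] by blast
  obtain l where "l \<in> L" "f y \<le> f l"
    using assms(1) f(1) \<open>y \<in> Y\<close> unfolding norming_def by blast
  then show False using f(2) f(3)[of l] L[of l] by simp
qed

text \<open>Let \<open>Q\<close> be the closed convex hull of \<open>Y\<close>, described by half-spaces, and \<open>L \<subseteq> Q\<close> a minimal norming set. Countably many small
  \<open>p\<close>-balls cover \<open>L\<close>, so by the Baire category theorem one of them, with centre \<open>d\<close>, contains a nonempty relatively open piece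
  \<open>L \<inter> W\<close>. By minimality some functional \<open>f\<close> stays below a bound \<open>m'\<close> on \<open>L - W\<close> that is
  smaller than its supremum \<open>m\<close> over \<open>Y\<close>. For large \<open>c\<close> the convex function \<open>\<lambda>x. p (x - d) + c * f x\<close>
  is at most \<open>e / 8 + c * m\<close> on \<open>L\<close>: on \<open>W\<close> because \<open>p (x - d)\<close> is small, elsewhere because \<open>f\<close> is. The maximum principle
  transfers this bound to \<open>Y\<close>, so points of \<open>Y\<close> at which \<open>f\<close> is close to \<open>m\<close> are close to \<open>d\<close>.\<close>

theorem weakly_compact_countable_small_slice:
  fixes K Y :: "'a::{locally_convex_space, t2_space} set"
  assumes K: "compactin weak_topology K" "convex K" and Y: "Y \<subseteq> K" "countable Y" "Y \<noteq> {}"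
    and p: "continuous_seminorm p" and e: "0 < e"
  obtains f \<alpha> y0 where "f \<in> topological_dual" "y0 \<in> Y" "\<alpha> < f y0"
    "\<And>y z. y \<in> Y \<Longrightarrow> z \<in> Y \<Longrightarrow> \<alpha> < f y \<Longrightarrow> \<alpha> < f z \<Longrightarrow> p (y - z) < e"
proof -
  define I where "I = {(f, \<beta>). f \<in> topological_dual \<and> (\<forall>y\<in>Y. f y \<le> \<beta>)}"
  define Q where "Q = {x. \<forall>i\<in>I. fst i x \<le> snd i} \<inter> K"
  have Q: "compactin weak_topology Q"
    unfolding Q_def using K(1) by (intro closed_Int_compactin closedin_weak_halfspaces) (auto simp: I_def)
  have YQ: "Y \<subseteq> Q" using Y(1) by (auto simp: Q_def I_def)
  have Qle: "f x \<le> \<beta>" if "x \<in> Q" "f \<in> topological_dual" "\<And>y. y \<in> Y \<Longrightarrow> f y \<le> \<beta>" for f x \<beta>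
    using that by (force simp: Q_def I_def)
  obtain L where L: "closedin weak_topology L" "L \<subseteq> Q" "norming Y L"
    and min: "\<And>L'. closedin weak_topology L' \<Longrightarrow> L' \<subset> L \<Longrightarrow> \<not> norming Y L'"
    using minimal_norming_set_exists[OF Q YQ Y(3)] by blast
  have Lc: "compactin weak_topology L" using closed_compactin[OF Q L(2,1)] .
  have "(\<lambda>x::'a. 0::real) \<in> topological_dual"
    by (simp add: topological_dual_def linear_iff)
  then have "L \<noteq> {}" using L(3) unfolding norming_def by blast
  let ?D = "rational_combinations Y"
  have "L \<subseteq> (\<Union>d\<in>?D. {x. p (x - d) \<le> e / 8})"
  proof
    fix x assume "x \<in> L"
    then have "x \<in> Q" using L(2) by blast
    obtain d where "d \<in> ?D" "p (x - d) < e / 8"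
      using rational_combinations_dense[OF p Y(3), of x "e / 8"] Qle[OF \<open>x \<in> Q\<close>] e by auto
    then show "x \<in> (\<Union>d\<in>?D. {x. p (x - d) \<le> e / 8})" by force
  qed
  then obtain d W l0 where W: "openin weak_topology W" "l0 \<in> L" "l0 \<in> W" "L \<inter> W \<subseteq> {x. p (x - d) \<le> e / 8}"
    using weakly_compact_Baire[OF Lc \<open>L \<noteq> {}\<close> countable_rational_combinations[OF Y(2)],
        of "\<lambda>d. {x. p (x - d) \<le> e / 8}"] closedin_weak_seminorm_ball[OF p] by metis
  have LW: "closedin weak_topology (L - W)" using L(1) W(1) by (rule closedin_diff)
  have "L - W \<subset> L" using W(2,3) by blast
  then obtain f where f: "f \<in> topological_dual" "\<And>l. l \<in> L - W \<Longrightarrow> \<exists>y\<in>Y. f l < f y"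
    using min[OF LW] unfolding norming_def by (auto simp: not_le)
  \<comment> \<open>If \<open>L - W\<close> is empty, any bound below a value of \<open>f\<close> on \<open>Y\<close> serves.\<close>
  obtain m' y1 where m': "y1 \<in> Y" "m' < f y1" "\<And>l. l \<in> L - W \<Longrightarrow> f l \<le> m'"
  proof (cases "L - W = {}")
    case True
    obtain y where "y \<in> Y" using Y(3) by blast
    then show ?thesis using that[of y "f y - 1"] True by auto
  next
    case False
    have "compactin weak_topology (L - W)" by (rule closed_compactin[OF Lc _ LW]) blast
    then obtain k where k: "k \<in> L - W" "\<And>x. x \<in> L - W \<Longrightarrow> f x \<le> f k"
      using weakly_compact_dual_attains_sup[OF _ False f(1)] by blast
    obtain y where "y \<in> Y" "f k < f y" using f(2)[OF k(1)] by blast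
    then show ?thesis using that[of y "f k"] k by blast
  qed
  obtain lM where lM: "lM \<in> L" "\<And>y. y \<in> Y \<Longrightarrow> f y \<le> f lM"
    using L(3) f(1) unfolding norming_def by blast
  define m where "m = f lM"
  have Lm: "f l \<le> m" if "l \<in> L" for l
    using Qle[OF _ f(1)] that L(2) lM(2) unfolding m_def by blast
  have "m' < m" using m'(1,2) lM(2) unfolding m_def by force
  obtain M where M: "0 < M" "\<And>x. x \<in> K \<Longrightarrow> p x \<le> M"
    using seminorm_bounded_on_weakly_compact[OF K p] by blast
  \<comment> \<open>Chosen so that \<open>c * (m - m')\<close> is a bound for \<open>p (l - d)\<close> on all of \<open>L\<close>.\<close>
  define c where "c = (M + p d) / (m - m')"
  have c: "0 \<le> c"
    using M(1) continuous_seminormD(7)[OF p, of d] \<open>m' < m\<close> by (simp add: c_def)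
  have main: "p (y - d) + c * f y \<le> e / 8 + c * m" if "y \<in> Y" for y
  proof (rule norming_maximum_principle[OF L(3), where \<Phi> = "\<lambda>x. p (x - d) + c * f x"])
    show "continuous_on UNIV (\<lambda>x. p (x - d) + c * f x)"
      using continuous_on_seminorm_dist[OF p] topological_dualD(2)[OF f(1)]
      by (intro continuous_intros) auto
    show "p (u *\<^sub>R x + v *\<^sub>R y - d) + c * f (u *\<^sub>R x + v *\<^sub>R y)
        \<le> u * (p (x - d) + c * f x) + v * (p (y - d) + c * f y)"
      if "0 \<le> u" "0 \<le> v" "u + v = 1" for x y u v
      using seminorm_dist_convex[OF p that, of x y d] by (simp add: topological_dualD[OF f(1)] algebra_simps)
    show "p (l - d) + c * f l \<le> e / 8 + c * m" if "l \<in> L" for l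
    proof (cases "l \<in> W")
      case True
      then have "p (l - d) \<le> e / 8" using W(4) that by blast
      then show ?thesis using mult_left_mono[OF Lm[OF that] c] by linarith
    next
      case False
      have "l \<in> K" using that L(2) by (auto simp: Q_def)
      then have "p (l - d) \<le> M + p d"
        using continuous_seminormD(9)[OF p, of l d] M(2)[of l] by linarith
      also have "\<dots> = c * (m - m')" using \<open>m' < m\<close> by (simp add: c_def)
      finally have "p (l - d) + c * m' \<le> c * m" by (simp add: algebra_simps)
      moreover have "c * f l \<le> c * m'" using m'(3)[of l] that False c by (intro mult_left_mono) auto
      ultimately show ?thesis using e by linarith
    qed
  qed (use that in auto)
  define \<alpha> where "\<alpha> = m - e / (8 * (c + 1))"
  have small: "p (y - d) < e / 2" if "y \<in> Y" "\<alpha> < f y" for y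
  proof -
    have "c * (m - f y) \<le> c * (e / (8 * (c + 1)))"
      using that(2) c by (intro mult_left_mono) (auto simp: \<alpha>_def)
    also have "\<dots> \<le> e / 8" using c e by (simp add: field_simps)
    finally have "c * m - c * f y \<le> e / 8" by (simp add: algebra_simps)
    then show ?thesis using main[OF that(1)] e by linarith
  qed
  have "\<exists>y\<in>Y. \<alpha> < f y"
  proof (rule ccontr)
    assume "\<not> (\<exists>y\<in>Y. \<alpha> < f y)"
    then have "f lM \<le> \<alpha>" using Qle[OF _ f(1)] lM(1) L(2) by (meson not_less subsetD)
    moreover have "0 < e / (8 * (c + 1))" using c e by simp
    ultimately show False unfolding \<alpha>_def m_def by linarith
  qed
  then obtain y0 where y0: "y0 \<in> Y" "\<alpha> < f y0" by blast
  have "p (y - z) < e" if "y \<in> Y" "z \<in> Y" "\<alpha> < f y" "\<alpha> < f z" for y z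
  proof -
    have "p (y - z) \<le> p (y - d) + p (z - d)"
      using continuous_seminormD(9)[OF p, of "y - d" "z - d"] by simp
    then show ?thesis using small[OF that(1,3)] small[OF that(2,4)] by simp
  qed
  then show ?thesis using that f(1) y0 by blast
qed

section \<open>Fixed points of distal semigroups\<close>

text \<open>For the Cesaro means \<open>z\<close> of an orbit, \<open>T z - z\<close> telescopes, so every functional \<open>f\<close> with \<open>\<bar>f\<bar> \<le> M\<close> on \<open>K\<close> satisfies
  \<open>f (T z) - f z \<le> 2 M / n\<close>. The points of \<open>K\<close> satisfying these inequalities for all \<open>f\<close> form decreasing nonempty compact
  sets \<open>U n\<close>, whose common points are fixed.\<close>

lemma markov_kakutani:
  fixes T :: "'a \<Rightarrow> 'a::{locally_convex_space, t2_space}"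
  assumes K: "compactin weak_topology K" "convex K" "K \<noteq> {}"
    and T: "linear T" "continuous_on UNIV T" "T ` K \<subseteq> K"
  obtains x where "x \<in> K" "T x = x"
proof -
  obtain y where y: "y \<in> K" using K(3) by blast
  have pow: "(T ^^ k) y \<in> K" for k
    using y T(3) by (induction k) auto
  define I where "I = {(f, M). f \<in> topological_dual \<and> (\<forall>x\<in>K. \<bar>f x\<bar> \<le> M)}"
  have M0: "0 \<le> M" if "(f, M) \<in> I" for f M
    using that y by (force simp: I_def)
  \<comment> \<open>The index is shifted by one to avoid the empty mean.\<close>
  define U where "U n = {x. \<forall>i\<in>I. fst i (T x) - fst i x \<le> 2 * snd i / Suc n} \<inter> K" for n :: nat
  have "\<Inter>(range U) \<noteq> {}"
  proof (rule compactin_chain_Inter[OF K(1)])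
    fix A B assume "A \<in> range U" "B \<in> range U"
    then obtain m n where mn: "A = U m" "B = U n" by blast
    have "U n \<subseteq> U m" if "m \<le> n" for m n
    proof
      fix x assume x: "x \<in> U n"
      have "fst i (T x) - fst i x \<le> 2 * snd i / Suc m" if i: "i \<in> I" for i
      proof -
        have "fst i (T x) - fst i x \<le> 2 * snd i / Suc n" using x i by (auto simp: U_def)
        also have "\<dots> \<le> 2 * snd i / Suc m"
          using M0[of "fst i" "snd i"] i \<open>m \<le> n\<close> by (intro divide_left_mono) auto
        finally show ?thesis .
      qed
      then show "x \<in> U m" using x by (auto simp: U_def)
    qed
    then show "A \<subseteq> B \<or> B \<subseteq> A" using mn by (metis linear)
  next
    fix A assume "A \<in> range U"
    then obtain n where A: "A = U n" by blast
    have "closedin weak_topology (U n)"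
      unfolding U_def
    proof (intro closedin_Int closedin_weak_halfspaces compactin_imp_closedin[OF Hausdorff_space_weak K(1)])
      fix i assume "i \<in> I"
      then have "fst i \<in> topological_dual" by (auto simp: I_def)
      then show "(\<lambda>x. fst i (T x) - fst i x) \<in> topological_dual"
        using topological_dual_diff[OF topological_dual_compose[OF _ T(1,2)]] by blast
    qed
    moreover have "U n \<subseteq> K" by (auto simp: U_def)
    moreover have "U n \<noteq> {}"
    proof -
      define z where "z = (1 / Suc n) *\<^sub>R (\<Sum>k<Suc n. (T ^^ k) y)"
      have "z = (\<Sum>k<Suc n. (1 / Suc n) *\<^sub>R (T ^^ k) y)"
        unfolding z_def by (rule scaleR_sum_right)
      also have "\<dots> \<in> K"
        using pow by (intro convex_sum K(2)) auto
      finally have zK: "z \<in> K" .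
      have "T z - z = (1 / Suc n) *\<^sub>R ((\<Sum>k<Suc n. (T ^^ Suc k) y) - (\<Sum>k<Suc n. (T ^^ k) y))"
        unfolding z_def by (simp add: linear_scale[OF T(1)] linear_sum[OF T(1)] scaleR_diff_right del: sum.lessThan_Suc)
      also have "(\<Sum>k<Suc n. (T ^^ Suc k) y) - (\<Sum>k<Suc n. (T ^^ k) y) = (T ^^ Suc n) y - y"
        unfolding sum_subtractf[symmetric] by (subst sum_lessThan_telescope) simp
      finally have Tz: "T z - z = (1 / Suc n) *\<^sub>R ((T ^^ Suc n) y - y)" .
      have "fst i (T z) - fst i z \<le> 2 * snd i / Suc n" if i: "i \<in> I" for i
      proof -
        have f: "fst i \<in> topological_dual" and b: "\<And>x. x \<in> K \<Longrightarrow> \<bar>fst i x\<bar> \<le> snd i"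
          using i by (auto simp: I_def)
        have "fst i (T z) - fst i z = fst i (T z - z)"
          by (rule topological_dualD(4)[OF f, symmetric])
        also have "\<dots> = (fst i ((T ^^ Suc n) y) - fst i y) / Suc n"
          unfolding Tz by (simp only: topological_dualD(4,5)[OF f] mult.left_neutral times_divide_eq_left)
        also have "\<dots> \<le> 2 * snd i / Suc n"
          using b[OF pow[of "Suc n"]] b[OF y] by (intro divide_right_mono) linarith+
        finally show ?thesis .
      qed
      then have "z \<in> U n" using zK by (simp add: U_def)
      then show ?thesis by blast
    qed
    ultimately show "closedin weak_topology A \<and> A \<subseteq> K \<and> A \<noteq> {}" using A by blast
  qed simp
  then obtain x where x: "\<And>n. x \<in> U n" by auto
  have "f (T x) \<le> f x" if f: "f \<in> topological_dual" for f
  proof -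
    obtain M where M: "\<And>x. x \<in> K \<Longrightarrow> \<bar>f x\<bar> \<le> M"
      using weakly_compact_dual_bounded[OF K(1) f] by blast
    then have "(f, M) \<in> I" using f by (auto simp: I_def)
    then have "f (T x) - f x \<le> (2 * M) * inverse (real (Suc n))" for n
      using x[of n] by (force simp: U_def divide_inverse)
    moreover have "(\<lambda>n. (2 * M) * inverse (real (Suc n))) \<longlonglongrightarrow> (2 * M) * 0"
      by (intro tendsto_mult tendsto_const LIMSEQ_inverse_real_of_nat)
    ultimately have "f (T x) - f x \<le> (2 * M) * 0"
      by (intro LIMSEQ_le_const) auto
    then show ?thesis by simp
  qed
  then have "T x = x" by (rule dual_eqI)
  moreover have "x \<in> K" using x[of 0] by (simp add: U_def)
  ultimately show ?thesis using that by blast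
qed

text \<open>A fixed point \<open>y\<close> of the average of \<open>F\<close> makes \<open>S y\<close> the mean of the points \<open>S (T y)\<close>, \<open>T \<in> F\<close>, for every word \<open>S\<close> in
  \<open>F\<close>. Only the maps in \<open>I\<close>, which move \<open>y\<close>, matter: dropping the others leaves the mean equal to
  \<open>S y\<close>. The seminorm \<open>q\<close> keeps \<open>S (T y)\<close> and \<open>S y\<close> at distance at least 1 for \<open>T \<in> I\<close>, against the small slice.\<close>

lemma distal_finite_common_fixed_point:
  fixes \<S> :: "('a \<Rightarrow> 'a::{locally_convex_space, t2_space}) set"
  assumes K: "compactin weak_topology K" "convex K" "K \<noteq> {}"
    and S: "\<And>T. T \<in> \<S> \<Longrightarrow> linear T \<and> continuous_on UNIV T \<and> T ` K \<subseteq> K"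
    and id: "id \<in> \<S>" and comp: "\<And>S T. S \<in> \<S> \<Longrightarrow> T \<in> \<S> \<Longrightarrow> S \<circ> T \<in> \<S>"
    and distal: "\<And>x y. x \<in> K \<Longrightarrow> y \<in> K \<Longrightarrow> x \<noteq> y \<Longrightarrow> 0 \<notin> closure {T x - T y |T. T \<in> \<S>}"
    and F: "finite F" "F \<subseteq> \<S>"
  obtains x where "x \<in> K" "\<And>T. T \<in> F \<Longrightarrow> T x = x"
proof (cases "F = {}")
  case True
  then show ?thesis using K(3) that by blast
next
  case False
  define n where "n = real (card F)"
  have n: "0 < n" using False F(1) by (simp add: n_def card_gt_0_iff)
  define A where "A x = (1 / n) *\<^sub>R (\<Sum>T\<in>F. T x)" for x
  have lin: "linear T" and cont: "continuous_on UNIV T" and maps: "x \<in> K \<Longrightarrow> T x \<in> K" if "T \<in> \<S>" for T x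
    using S[OF that] by auto
  have "linear A"
    unfolding A_def using F(2) lin
    by (intro linear_compose_scale_right linear_compose_sum) auto
  moreover have "continuous_on UNIV A"
    unfolding A_def using F(2) cont
    by (intro continuous_on_compose2[OF continuous_on_scaleR_tvs(2)] continuous_on_sum_tvs) auto
  moreover have "A ` K \<subseteq> K"
  proof clarify
    fix x assume "x \<in> K"
    have "(\<Sum>T\<in>F. (1 / n) *\<^sub>R T x) \<in> K"
      using F maps[OF _ \<open>x \<in> K\<close>] n by (intro convex_sum[OF _ K(2)]) (auto simp: n_def)
    then show "A x \<in> K" by (simp add: A_def scaleR_sum_right)
  qed
  ultimately obtain y where y: "y \<in> K" "A y = y"
    using markov_kakutani[OF K] by blast
  define I where "I = {T \<in> F. T y \<noteq> y}"
  have I: "finite I" "I \<subseteq> F" "I \<subseteq> \<S>" using F by (auto simp: I_def)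
  have "I = {}"
  proof (rule ccontr)
    assume "I \<noteq> {}"
    have "\<exists>p. continuous_seminorm p \<and> (\<forall>S\<in>\<S>. 1 \<le> p (S (T y) - S y))" if "T \<in> I" for T
    proof -
      have "0 \<notin> closure {S (T y) - S y |S. S \<in> \<S>}"
        using that I maps[of T y] y(1) by (intro distal) (auto simp: I_def)
      then show ?thesis by (rule not_in_closure_seminorm) blast
    qed
    then obtain p where p: "\<And>T. T \<in> I \<Longrightarrow> continuous_seminorm (p T)"
      "\<And>T S. T \<in> I \<Longrightarrow> S \<in> \<S> \<Longrightarrow> 1 \<le> p T (S (T y) - S y)" by metis
    define q where "q x = (\<Sum>T\<in>I. p T x)" for x
    have q: "continuous_seminorm q"
      unfolding q_def using I(1) p(1) by (rule continuous_seminorm_sum)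
    have q_ge: "1 \<le> q (S (T y) - S y)" if "T \<in> I" "S \<in> \<S>" for T S
    proof -
      have "p T (S (T y) - S y) \<le> q (S (T y) - S y)"
        unfolding q_def using I(1) that(1) continuous_seminormD(7)[OF p(1)] by (intro member_le_sum) auto
      then show ?thesis using p(2)[OF that] by linarith
    qed
    \<comment> \<open>Words in \<open>F\<close> replace the semigroup, which may be uncountable.\<close>
    define word where "word w = foldr (\<circ>) w id" for w :: "('a \<Rightarrow> 'a) list"
    have word: "word w \<in> \<S>" if "w \<in> lists F" for w
      using that F(2) id comp unfolding word_def by (induction w) auto
    have fold: "foldr (\<circ>) w T = foldr (\<circ>) w id \<circ> T" for w and T :: "'a \<Rightarrow> 'a"
      by (induction w) (auto simp: comp_assoc)
    have word_snoc: "word (w @ [T]) = word w \<circ> T" for w T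
      using fold[of w T] by (simp only: word_def foldr_append foldr.simps o_apply comp_id)
    define Y where "Y = (\<lambda>w. word w y) ` lists F"
    have Y1: "Y \<subseteq> K" using word maps y(1) by (auto simp: Y_def)
    have Y2: "countable Y"
      unfolding Y_def using F(1) by (intro countable_image countable_lists countable_finite)
    have Y3: "Y \<noteq> {}" by (auto simp: Y_def)
    obtain f \<alpha> y0 where f: "f \<in> topological_dual" "y0 \<in> Y" "\<alpha> < f y0"
      "\<And>y z. y \<in> Y \<Longrightarrow> z \<in> Y \<Longrightarrow> \<alpha> < f y \<Longrightarrow> \<alpha> < f z \<Longrightarrow> q (y - z) < 1"
      using weakly_compact_countable_small_slice[OF K(1,2) Y1 Y2 Y3 q zero_less_one] by metis
    obtain w where w: "w \<in> lists F" "y0 = word w y" using f(2) by (auto simp: Y_def)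
    let ?S = "word w"
    have linS: "linear ?S" using lin[OF word[OF w(1)]] .
    have "f (?S y) = f (?S (A y))" using y(2) by simp
    also have "\<dots> = (1 / n) * (\<Sum>T\<in>F. f (?S (T y)))"
      unfolding A_def
      by (simp add: linear_scale[OF linS] linear_sum[OF linS] topological_dualD(5)[OF f(1)] linear_sum[OF topological_dualD(1)[OF f(1)]])
    finally have "(\<Sum>T\<in>F. f (?S (T y))) = n * f (?S y)" using n by (simp add: field_simps)
    then have "(\<Sum>T\<in>F. f (?S (T y)) - f (?S y)) = 0"
      by (simp add: sum_subtractf n_def)
    moreover have "(\<Sum>T\<in>F. f (?S (T y)) - f (?S y)) = (\<Sum>T\<in>I. f (?S (T y)) - f (?S y))"
      using F(1) I(2) by (intro sum.mono_neutral_right) (auto simp: I_def)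
    ultimately have sum0: "(\<Sum>T\<in>I. f (?S (T y)) - f (?S y)) = 0" by simp
    have "\<exists>T\<in>I. f (?S y) \<le> f (?S (T y))"
    proof (rule ccontr)
      assume "\<not> (\<exists>T\<in>I. f (?S y) \<le> f (?S (T y)))"
      then have "(\<Sum>T\<in>I. f (?S (T y)) - f (?S y)) < (\<Sum>T\<in>I. 0)"
        using I(1) \<open>I \<noteq> {}\<close> by (intro sum_strict_mono) (auto simp: not_le)
      then show False using sum0 by simp
    qed
    then obtain T where T: "T \<in> I" "f (?S y) \<le> f (?S (T y))" by blast
    have "?S (T y) \<in> Y"
      unfolding Y_def using w(1) T(1) I(2) word_snoc[of w T]
      by (intro image_eqI[of _ _ "w @ [T]"]) auto
    then have "q (?S (T y) - ?S y) < 1"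
      using f(2,3,4) w(2) T(2) by auto
    then show False using q_ge[OF T(1) word[OF w(1)]] by simp
  qed
  then show ?thesis using that[OF y(1)] by (auto simp: I_def)
qed

text \<open>The fixed point sets of single maps are weakly closed, and finitely many of them meet in \<open>K\<close>.\<close>

theorem distal_common_fixed_point:
  fixes \<S> :: "('a \<Rightarrow> 'a::{locally_convex_space, t2_space}) set"
  assumes K: "compactin weak_topology K" "convex K" "K \<noteq> {}"
    and S: "\<And>T. T \<in> \<S> \<Longrightarrow> linear T \<and> continuous_on UNIV T \<and> T ` K \<subseteq> K"
    and id: "id \<in> \<S>" and comp: "\<And>S T. S \<in> \<S> \<Longrightarrow> T \<in> \<S> \<Longrightarrow> S \<circ> T \<in> \<S>"
    and distal: "\<And>x y. x \<in> K \<Longrightarrow> y \<in> K \<Longrightarrow> x \<noteq> y \<Longrightarrow> 0 \<notin> closure {T x - T y |T. T \<in> \<S>}"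
  obtains x where "x \<in> K" "\<And>T. T \<in> \<S> \<Longrightarrow> T x = x"
proof -
  define Fix where "Fix T = {x. T x = x}" for T :: "'a \<Rightarrow> 'a"
  have closed: "closedin weak_topology (Fix T)" if "T \<in> \<S>" for T
  proof -
    have "closedin weak_topology {x. \<forall>f\<in>topological_dual. f (T x) - f x \<le> 0}"
      using S[OF that] by (intro closedin_weak_halfspaces topological_dual_diff[OF topological_dual_compose]) auto
    also have "{x. \<forall>f\<in>topological_dual. f (T x) - f x \<le> 0} = Fix T"
      by (auto simp: Fix_def intro: dual_eqI)
    finally show ?thesis .
  qed
  have "K \<inter> \<Inter>\<F> \<noteq> {}" if fin: "finite \<F>" "\<F> \<subseteq> Fix ` \<S>" for \<F>
  proof -
    obtain F where F: "finite F" "F \<subseteq> \<S>" "\<F> = Fix ` F"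
      using finite_subset_image[OF fin] by blast
    obtain x where "x \<in> K" "\<And>T. T \<in> F \<Longrightarrow> T x = x"
      using distal_finite_common_fixed_point[OF K S id comp distal F(1,2)] by blast
    then show ?thesis using F(3) by (auto simp: Fix_def)
  qed
  then have "K \<inter> \<Inter>(Fix ` \<S>) \<noteq> {}"
    using closed by (intro compactin_fipD[OF K(1), of "Fix ` \<S>"]) blast+
  then show ?thesis using that by (auto simp: Fix_def)
qed

section \<open>Distal actions on cones\<close>

theorem theorem12:
  fixes G :: "('g, 'm) monoid_scheme"
    and \<pi> :: "'g \<Rightarrow> 'a \<Rightarrow> 'a::{locally_convex_space, t2_space}"
    and C :: "'a set"
  assumes "convex_cone C" and "proper_cone C" and "weakly_locally_compact C"
    and "cone_representation G \<pi> C"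
    and "locally_bounded_type G \<pi> C"
    and "distal_on G \<pi> C"
  shows "\<exists>x\<in>C. x \<noteq> 0 \<and> (\<forall>g\<in>carrier G. \<pi> g x = x)"
proof -
  interpret group_action G UNIV \<pi>
    using assms(4) by (simp add: cone_representation_def)
  interpret group G using group_hom by (simp add: group_hom_def)
  have \<pi>: "linear (\<pi> g)" "continuous_on UNIV (\<pi> g)" "\<And>c. c \<in> C \<Longrightarrow> \<pi> g c \<in> C" if "g \<in> carrier G" for g
    using assms(4) that by (auto simp: cone_representation_def)
  have \<pi>_mult: "\<pi> (g \<otimes>\<^bsub>G\<^esub> h) x = \<pi> g (\<pi> h x)" if "g \<in> carrier G" "h \<in> carrier G" for g h x
    using composition_rule[of x g h] that by simp
  have \<pi>_one: "\<pi> \<one>\<^bsub>G\<^esub> x = x" for x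
    using id_eq_one by (metis UNIV_I restrict_apply)
  obtain \<phi> where \<phi>: "\<phi> \<in> topological_dual" "\<And>c. c \<in> C \<Longrightarrow> c \<noteq> 0 \<Longrightarrow> 0 < \<phi> c"
    "\<And>r. compactin weak_topology {c \<in> C. \<phi> c \<le> r}"
    using weakly_locally_compact_cone_compact_base[OF assms(1-3)] by blast
  obtain x where x: "x \<in> C" "x \<noteq> 0" "tvs_bounded (orbit G \<pi> x)"
    using assms(5) by (auto simp: locally_bounded_type_def)
  have C0: "0 \<in> C" using assms(2) by (auto simp: proper_cone_def)
  have \<pi>_dual: "(\<lambda>y. \<phi> (\<pi> g y)) \<in> topological_dual" if "g \<in> carrier G" for g
    by (rule topological_dual_compose[OF \<phi>(1) \<pi>(1,2)[OF that]])
  have "open {y. \<bar>\<phi> y\<bar> < 1}"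
    using topological_dualD(2)[OF \<phi>(1)] by (intro open_Collect_less continuous_intros) auto
  moreover have "0 \<in> {y. \<bar>\<phi> y\<bar> < 1}" using topological_dualD(6)[OF \<phi>(1)] by simp
  ultimately obtain M where M: "0 < M" "\<And>t. M \<le> \<bar>t\<bar> \<Longrightarrow> orbit G \<pi> x \<subseteq> (\<lambda>y. t *\<^sub>R y) ` {y. \<bar>\<phi> y\<bar> < 1}"
    using x(3) unfolding tvs_bounded_def by blast
  have upper: "\<phi> (\<pi> g x) \<le> M" if "g \<in> carrier G" for g
  proof -
    have "\<pi> g x \<in> orbit G \<pi> x" using that by (auto simp: orbit_def)
    moreover have "orbit G \<pi> x \<subseteq> (\<lambda>y. M *\<^sub>R y) ` {y. \<bar>\<phi> y\<bar> < 1}" by (rule M(2)) simp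
    ultimately obtain y where "\<pi> g x = M *\<^sub>R y" "\<bar>\<phi> y\<bar> < 1" by blast
    then show ?thesis
      using topological_dualD(5)[OF \<phi>(1), of M y] M(1) mult_left_le[of "\<phi> y" M] by simp
  qed
  have "0 \<notin> closure {\<pi> g x - \<pi> g 0 |g. g \<in> carrier G}"
    using assms(6) x(1,2) C0 by (simp add: distal_on_def)
  then obtain p where p: "continuous_seminorm p" "\<And>a. a \<in> {\<pi> g x - \<pi> g 0 |g. g \<in> carrier G} \<Longrightarrow> 1 \<le> p a"
    by (rule not_in_closure_seminorm) blast
  have p1: "1 \<le> p (\<pi> g x)" if "g \<in> carrier G" for g
  proof -
    have "\<pi> g 0 = 0" using \<pi>(1)[OF that] by (rule linear_0)
    then show ?thesis using p(2)[of "\<pi> g x"] that by force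
  qed
  have convC: "convex C" using assms(1) by (simp add: convex_cone_def)
  have "{c \<in> C. \<phi> c \<le> 1} = C \<inter> {c. \<forall>i\<in>{()}. \<phi> c \<le> 1}" by auto
  moreover have "convex {c. \<forall>i\<in>{()}. \<phi> c \<le> 1}"
    using topological_dualD(1)[OF \<phi>(1)] by (intro convex_halfspaces)
  ultimately have "convex {c \<in> C. \<phi> c \<le> 1}" using convC by (simp add: convex_Int)
  then obtain N where N: "0 < N" "\<And>y. y \<in> {c \<in> C. \<phi> c \<le> 1} \<Longrightarrow> p y \<le> N"
    using seminorm_bounded_on_weakly_compact[OF \<phi>(3) _ p(1)] by blast
  \<comment> \<open>Scaling \<open>\<pi> g x\<close> to \<open>\<phi>\<close>-value 1 brings it into the section on which \<open>p\<close> is at most \<open>N\<close>.\<close>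
  have lower: "1 / N \<le> \<phi> (\<pi> g x)" if g: "g \<in> carrier G" for g
  proof -
    let ?y = "\<pi> g x"
    have y: "?y \<in> C" using \<pi>(3)[OF g x(1)] .
    have "?y \<noteq> 0" using p1[OF g] continuous_seminormD(6)[OF p(1)] by force
    then have pos: "0 < \<phi> ?y" using \<phi>(2) y by blast
    have "(1 / \<phi> ?y) *\<^sub>R ?y \<in> C" using y pos by (simp add: convex_cone_scaleR[OF assms(1)])
    moreover have "\<phi> ((1 / \<phi> ?y) *\<^sub>R ?y) \<le> 1"
      using pos by (simp add: topological_dualD(5)[OF \<phi>(1)])
    ultimately have "p ((1 / \<phi> ?y) *\<^sub>R ?y) \<le> N" using N(2) by blast
    then have "p ?y / \<phi> ?y \<le> N" using pos by (simp add: continuous_seminormD(5)[OF p(1)])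
    then have "p ?y \<le> N * \<phi> ?y" using pos by (simp add: pos_divide_le_eq)
    then have "1 \<le> N * \<phi> ?y" using p1[OF g] by linarith
    then show ?thesis using N(1) by (simp add: pos_divide_le_eq mult.commute)
  qed
  \<comment> \<open>The upper bound on the section gives compactness; the two families of half-spaces run over the whole orbit to give invariance.\<close>
  define K where "K = {y. \<forall>g\<in>carrier G. \<phi> (\<pi> g y) \<le> M} \<inter> ({y. \<forall>g\<in>carrier G. - \<phi> (\<pi> g y) \<le> - (1 / N)} \<inter> {c \<in> C. \<phi> c \<le> M})"
  have Kiff: "y \<in> K \<longleftrightarrow> y \<in> C \<and> (\<forall>g\<in>carrier G. 1 / N \<le> \<phi> (\<pi> g y) \<and> \<phi> (\<pi> g y) \<le> M)" for y
  proof -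
    have "\<phi> y \<le> M" if "\<forall>g\<in>carrier G. \<phi> (\<pi> g y) \<le> M"
      using bspec[OF that one_closed] by (simp add: \<pi>_one)
    then show ?thesis by (auto simp: K_def)
  qed
  have Kc: "compactin weak_topology K"
    unfolding K_def using \<pi>_dual topological_dual_uminus[OF \<pi>_dual] \<phi>(3)
    by (intro closed_Int_compactin closedin_weak_halfspaces)
  have "K = {y. \<forall>g\<in>carrier G. \<phi> (\<pi> g y) \<le> M} \<inter> ({y. \<forall>g\<in>carrier G. - \<phi> (\<pi> g y) \<le> - (1 / N)} \<inter> C)"
    using Kiff by auto
  then have Kconv: "convex K"
    using topological_dualD(1)[OF \<pi>_dual] topological_dualD(1)[OF topological_dual_uminus[OF \<pi>_dual]] convC
    by (simp only:) (intro convex_Int convex_halfspaces)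
  have "x \<in> K" using x(1) upper lower Kiff by blast
  then have Kne: "K \<noteq> {}" by blast
  have Kinv: "\<pi> g y \<in> K" if "g \<in> carrier G" "y \<in> K" for g y
    using that \<pi>(3) \<pi>_mult[symmetric] by (auto simp: Kiff)
  obtain z where z: "z \<in> K" "\<And>T. T \<in> \<pi> ` carrier G \<Longrightarrow> T z = z"
  proof (rule distal_common_fixed_point[OF Kc Kconv Kne, of "\<pi> ` carrier G"])
    show "linear T \<and> continuous_on UNIV T \<and> T ` K \<subseteq> K" if "T \<in> \<pi> ` carrier G" for T
      using that \<pi>(1,2) Kinv by auto
    show "id \<in> \<pi> ` carrier G"
      using \<pi>_one by (intro image_eqI[of _ _ "\<one>\<^bsub>G\<^esub>"]) auto
    show "S \<circ> T \<in> \<pi> ` carrier G" if ST: "S \<in> \<pi> ` carrier G" "T \<in> \<pi> ` carrier G" for S T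
    proof -
      obtain g h where "g \<in> carrier G" "h \<in> carrier G" "S = \<pi> g" "T = \<pi> h" using ST by blast
      then show ?thesis
        using \<pi>_mult by (intro image_eqI[of _ _ "g \<otimes>\<^bsub>G\<^esub> h"]) auto
    qed
    show "0 \<notin> closure {T x - T y |T. T \<in> \<pi> ` carrier G}" if "x \<in> K" "y \<in> K" "x \<noteq> y" for x y
    proof -
      have "{T x - T y |T. T \<in> \<pi> ` carrier G} = {\<pi> g x - \<pi> g y |g. g \<in> carrier G}" by blast
      moreover have "x \<in> C" "y \<in> C" using that Kiff by blast+
      ultimately show ?thesis using assms(6) that(3) by (simp add: distal_on_def)
    qed
  qed blast
  have "1 / N \<le> \<phi> (\<pi> \<one>\<^bsub>G\<^esub> z)" using z(1) one_closed unfolding Kiff by blast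
  moreover have "0 < 1 / N" using N(1) by simp
  ultimately have "0 < \<phi> z" unfolding \<pi>_one by linarith
  then have "z \<noteq> 0" using topological_dualD(6)[OF \<phi>(1)] by auto
  then show ?thesis using z Kiff by (intro bexI[of _ z]) auto
qed

end
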